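(* Let $I=[\alpha,\beta]$ with $0<\alpha<\beta<\infty$, and set $a=\beta/\alpha>1$. Then the limiting objects $\Lambda_I$, $J_I$, $\mathcal C_I$ associated with $I$ satisfy $$\Lambda_I(\theta)=\alpha^{-1}\Lambda_a(\theta),\qquad J_I(x)=\alpha^{-1}J_a(\alpha x),\qquad \mathcal C_I(\theta)=\mathcal C_a(\theta).$$ Moreover, the variables $N_I(L)/L$ satisfy a large deviations principle on $[0,\infty)$ with speed $L$ (as $L\to\infty$) and good rate function $J_I$, and $$\log\mathbb E\exp(\theta N_I(L))=L\Lambda_I(\theta)+\mathcal C_I(\theta)+o(1),\qquad L\to\infty,$$ locally uniformly for $\theta\in S_\pi$.
   Context: Let $\mathbb H=\{z\in\mathbb C:\operatorname{Im}z>0\}$ with planar Lebesgue measure $\mathrm dA$, and let $\mathcal Z$ be the determinantal point process on $(\mathbb H,\mathrm dA)$ with Hermitian correlation kernel $K_{\mathbb H}(z,w)=-\frac{1}{\pi(z-\overline w)^2}$. For a compact interval $I\subset(0,\infty)$ and $L>0$ set $N_I(L):=\#\{z\in\mathcal Z:0\le\operatorname{Re}z\le L,\ \operatorname{Im}z\in I\}$. Let $S_\pi:=\{\theta\in\mathbb C:|\operatorname{Im}\theta|<\pi\}$. Logarithms $\log\mathbb E\exp(\theta N_I(L))$ for $\theta\in S_\pi$ are the holomorphic branches on $S_\pi$ vanishing at $\theta=0$. Objects for $I$: $\Lambda_I(\theta):=\lim_{L\to\infty}\frac1L\log\mathbb E\exp(\theta N_I(L))$ for real $\theta$ (extended holomorphically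 to $S_\pi$), $J_I(x):=\sup_{\theta\in\mathbb R}\{\theta x-\Lambda_I(\theta)\}$ for $x\ge0$, and $\mathcal C_I(\theta):=\lim_{L\to\infty}\left[\log\mathbb E\exp(\theta N_I(L))-L\Lambda_I(\theta)\right]$ for $\theta\in S_\pi$ (the strong Szegő correction; part of the assertion is that these limits exist). For the reference intervals $[1,a]$, $a>1$, write $\Lambda_a:=\Lambda_{[1,a]}$, $J_a:=J_{[1,a]}$, $\mathcal C_a:=\mathcal C_{[1,a]}$. For these intervals the limits exist: $\Lambda_a(\theta)=\frac1{2\pi}\int_0^\infty\log(1+(e^\theta-1)(e^{-2\xi}-e^{-2a\xi}))\,\mathrm d\xi$ (branch of the logarithm continued analytically from $\theta=0$), and $\mathcal C_a$ is a holomorphic function on $S_\pi$, the convergence to it being locally uniform on $S_\pi$. A large deviations principle on $[0,\infty)$ with speed $L$ and good rate function $J$ means: $J$ is lower semicontinuous with compact sublevel sets, and for every Borel $A\subset[0,\infty)$, $-\inf_{A^\circ}J\le\liminf\frac1L\log\mathbb P(N_I(L)/L\in A)\le\limsup\frac1L\log\mathbb P(N_I(L)/L\in A)\le-\inf_{\overline A}J$, with interior and closure relative to $[0,\infty)$. *)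

theory Defs
  imports "HOL-Probability.Probability" "Jordan_Normal_Form.Determinant"
begin

definition upper_half_plane :: "complex set" where
  "upper_half_plane = {z. 0 < Im z}"

definition K_H :: "complex \<Rightarrow> complex \<Rightarrow> complex" where
  "K_H z w = - (1 / (of_real pi * (z - cnj w)\<^sup>2))"

text \<open>
  A simple point process on an open set \<open>U\<close> of the plane: a random subset of \<open>U\<close> without
  accumulation point in \<open>U\<close>, such that the number of points in every Borel set whose closure
  is compact in \<open>U\<close> is a random variable.
\<close>

definition simple_point_process ::
  "'w measure \<Rightarrow> complex set \<Rightarrow> ('w \<Rightarrow> complex set) \<Rightarrow> bool" where
  "simple_point_process M U Z \<longleftrightarrow>
     prob_space M \<and>
     (\<forall>\<omega>\<in>space M. Z \<omega> \<subseteq> U \<and> (\<forall>C. compact C \<and> C \<subseteq> U \<longrightarrow> finite (Z \<omega> \<inter> C))) \<and>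
     (\<forall>D C. D \<in> sets borel \<and> compact C \<and> C \<subseteq> U \<and> D \<subseteq> C \<longrightarrow>
        (\<lambda>\<omega>. card (Z \<omega> \<inter> D)) \<in> measurable M (count_space UNIV))"

text \<open>
  The process is determinantal with kernel \<open>K\<close> with respect to planar Lebesgue measure if,
  for every \<open>n\<close>, its \<open>n\<close>-th factorial moment measure (the expected number of \<open>n\<close>-tuples of
  pairwise distinct points of the process in a given Borel subset of \<open>U\<^sup>n\<close>) has density
  \<open>det (K (z i) (z j))\<close>, \<open>i, j < n\<close>. Tuples are extensional functions on \<open>{..<n}\<close>. For a
  Hermitian positive semidefinite kernel the determinant is a nonnegative real, so that
  \<open>ennreal \<circ> Re\<close> loses nothing.
\<close>

definition determinantal_process ::
  "'w measure \<Rightarrow> complex set \<Rightarrow> (complex \<Rightarrow> complex \<Rightarrow> complex) \<Rightarrow> ('w \<Rightarrow> complex set) \<Rightarrow> bool"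
where
  "determinantal_process M U K Z \<longleftrightarrow>
     simple_point_process M U Z \<and>
     (\<forall>n. \<forall>B \<in> sets (PiM {..<n} (\<lambda>_. lborel)). B \<subseteq> PiE {..<n} (\<lambda>_. U) \<longrightarrow>
        (\<integral>\<^sup>+ \<omega>. emeasure (count_space UNIV)
                  {z \<in> B. inj_on z {..<n} \<and> (\<forall>i<n. z i \<in> Z \<omega>)} \<partial>M) =
        (\<integral>\<^sup>+ z \<in> B. ennreal (Re (Determinant.det
                  (Matrix.mat n n (\<lambda>(i, j). K (z i) (z j))))) \<partial>(PiM {..<n} (\<lambda>_. lborel))))"

definition box_count :: "('w \<Rightarrow> complex set) \<Rightarrow> real set \<Rightarrow> real \<Rightarrow> 'w \<Rightarrow> nat" where
  "box_count Z I L \<omega> = card {z \<in> Z \<omega>. 0 \<le> Re z \<and> Re z \<le> L \<and> Im z \<in> I}"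

definition S_pi :: "complex set" where
  "S_pi = {\<theta>. \<bar>Im \<theta>\<bar> < pi}"

definition mgf ::
  "'w measure \<Rightarrow> ('w \<Rightarrow> complex set) \<Rightarrow> real set \<Rightarrow> real \<Rightarrow> complex \<Rightarrow> complex" where
  "mgf M Z I L \<theta> = (\<integral>\<omega>. exp (\<theta> * of_nat (box_count Z I L \<omega>)) \<partial>M)"

text \<open>
  Since \<open>exp\<close> has no zero and the Bochner integral of a non-integrable function is \<open>0\<close>, a branch
  of the logarithm can exist only if the exponential moments are genuinely finite. As \<open>S_pi\<close> is
  connected, the branch is unique on \<open>S_pi\<close>; the values of \<open>log_mgf\<close> elsewhere mean nothing.
\<close>

definition is_log_mgf ::
  "'w measure \<Rightarrow> ('w \<Rightarrow> complex set) \<Rightarrow> real set \<Rightarrow> real \<Rightarrow> (complex \<Rightarrow> complex) \<Rightarrow> bool" where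
  "is_log_mgf M Z I L g \<longleftrightarrow>
     g holomorphic_on S_pi \<and> g 0 = 0 \<and> (\<forall>\<theta>\<in>S_pi. exp (g \<theta>) = mgf M Z I L \<theta>)"

definition log_mgf ::
  "'w measure \<Rightarrow> ('w \<Rightarrow> complex set) \<Rightarrow> real set \<Rightarrow> real \<Rightarrow> complex \<Rightarrow> complex" where
  "log_mgf M Z I L = (SOME g. is_log_mgf M Z I L g)"

definition Lambda_real ::
  "'w measure \<Rightarrow> ('w \<Rightarrow> complex set) \<Rightarrow> real set \<Rightarrow> real \<Rightarrow> real" where
  "Lambda_real M Z I \<theta> =
     Lim at_top (\<lambda>L. ln (\<integral>\<omega>. exp (\<theta> * real (box_count Z I L \<omega>)) \<partial>M) / L)"

definition Lambda ::
  "'w measure \<Rightarrow> ('w \<Rightarrow> complex set) \<Rightarrow> real set \<Rightarrow> complex \<Rightarrow> complex" where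
  "Lambda M Z I = (SOME g. g holomorphic_on S_pi \<and>
     (\<forall>\<theta>::real. g (of_real \<theta>) = of_real (Lambda_real M Z I \<theta>)))"

definition rate_J ::
  "'w measure \<Rightarrow> ('w \<Rightarrow> complex set) \<Rightarrow> real set \<Rightarrow> real \<Rightarrow> ereal" where
  "rate_J M Z I x = (SUP \<theta>::real. ereal (\<theta> * x - Lambda_real M Z I \<theta>))"

definition szego_C ::
  "'w measure \<Rightarrow> ('w \<Rightarrow> complex set) \<Rightarrow> real set \<Rightarrow> complex \<Rightarrow> complex" where
  "szego_C M Z I \<theta> =
     Lim at_top (\<lambda>L. log_mgf M Z I L \<theta> - of_real L * Lambda M Z I \<theta>)"

text \<open>
  The objects above are given by \<open>Lim\<close> and \<open>SOME\<close>; the following says that they are well defined.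
\<close>

definition limits_exist ::
  "'w measure \<Rightarrow> ('w \<Rightarrow> complex set) \<Rightarrow> real set \<Rightarrow> bool" where
  "limits_exist M Z I \<longleftrightarrow>
     (\<forall>L>0. is_log_mgf M Z I L (log_mgf M Z I L)) \<and>
     (\<forall>\<theta>::real. ((\<lambda>L. ln (\<integral>\<omega>. exp (\<theta> * real (box_count Z I L \<omega>)) \<partial>M) / L)
                  \<longlongrightarrow> Lambda_real M Z I \<theta>) at_top) \<and>
     Lambda M Z I holomorphic_on S_pi \<and>
     (\<forall>\<theta>::real. Lambda M Z I (of_real \<theta>) = of_real (Lambda_real M Z I \<theta>)) \<and>
     (\<forall>\<theta>\<in>S_pi. ((\<lambda>L. log_mgf M Z I L \<theta> - of_real L * Lambda M Z I \<theta>)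
                  \<longlongrightarrow> szego_C M Z I \<theta>) at_top)"

definition szego_locally_uniform ::
  "'w measure \<Rightarrow> ('w \<Rightarrow> complex set) \<Rightarrow> real set \<Rightarrow> bool" where
  "szego_locally_uniform M Z I \<longleftrightarrow>
     (\<forall>C. compact C \<and> C \<subseteq> S_pi \<longrightarrow>
        uniform_limit C (\<lambda>L \<theta>. log_mgf M Z I L \<theta> - of_real L * Lambda M Z I \<theta>)
          (szego_C M Z I) at_top)"

text \<open>
  For \<open>\<theta> \<in> S_pi\<close> and \<open>0 < p < 1\<close> the number \<open>1 + (exp \<theta> - 1) * p\<close> lies off the half-line
  \<open>(-\<infinity>, 0]\<close>, so the principal branch \<open>Ln\<close> is the continuation from \<open>\<theta> = 0\<close>.
\<close>

definition Lambda_formula :: "real \<Rightarrow> complex \<Rightarrow> complex" where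
  "Lambda_formula a \<theta> = 1 / (2 * of_real pi) *
     (LBINT \<xi>:{0<..}. Ln (1 + (exp \<theta> - 1) * of_real (exp (- 2 * \<xi>) - exp (- 2 * a * \<xi>))))"

text \<open>The known asymptotics for the reference interval \<open>[1, a]\<close>.\<close>

definition reference_asymptotics ::
  "'w measure \<Rightarrow> ('w \<Rightarrow> complex set) \<Rightarrow> real \<Rightarrow> bool" where
  "reference_asymptotics M Z a \<longleftrightarrow>
     limits_exist M Z {1..a} \<and>
     (\<forall>\<theta>\<in>S_pi. Lambda M Z {1..a} \<theta> = Lambda_formula a \<theta>) \<and>
     szego_C M Z {1..a} holomorphic_on S_pi \<and>
     szego_locally_uniform M Z {1..a}"

text \<open>\<open>ln 0 = 0\<close> in the library, whereas large deviations require \<open>log 0 = -\<infinity>\<close>.\<close>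

definition log_prob :: "real \<Rightarrow> ereal" where
  "log_prob p = (if p = 0 then - \<infinity> else ereal (ln p))"

definition good_rate_function :: "(real \<Rightarrow> ereal) \<Rightarrow> bool" where
  "good_rate_function J \<longleftrightarrow>
     (\<forall>x\<in>{0..}. J x \<le> Liminf (at x within {0..}) J) \<and>
     (\<forall>c::real. compact {x\<in>{0..}. J x \<le> ereal c})"

definition LDP_nonneg ::
  "'w measure \<Rightarrow> (real \<Rightarrow> 'w \<Rightarrow> real) \<Rightarrow> (real \<Rightarrow> ereal) \<Rightarrow> bool" where
  "LDP_nonneg M X J \<longleftrightarrow>
     good_rate_function J \<and>
     (\<forall>A. A \<in> sets borel \<and> A \<subseteq> {0..} \<longrightarrow>
        (let r = (\<lambda>L. log_prob (measure M {\<omega> \<in> space M. X L \<omega> \<in> A}) / ereal L) in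
         - (INF x \<in> top_of_set {0..} interior_of A. J x) \<le> Liminf at_top r \<and>
         Liminf at_top r \<le> Limsup at_top r \<and>
         Limsup at_top r \<le> - (INF x \<in> top_of_set {0..} closure_of A. J x)))"

end

theory Submission
  imports Defs "HOL-Complex_Analysis.Complex_Analysis"
begin

text \<open>
  The process looks the same at every scale: \<open>K_H (c z) (c w) = K_H z w / c\<^sup>2\<close> for \<open>c > 0\<close>, and the
  factor \<open>c\<^sup>-\<^sup>2\<close> per point cancels the factor \<open>c\<^sup>2\<close> by which the dilation enlarges area. So the
  factorial moments of the number of points in a set and in its dilate agree
  (\<open>factorial_moment_dilation\<close>). Dilation by \<open>\<alpha>\<close> maps \<open>[0, L / \<alpha>] \<times> [1, a]\<close> onto
  \<open>[0, L] \<times> [\<alpha>, \<beta>]\<close>. That the logarithm of the generating function exists for the reference box makes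
  all exponential moments of its count finite, and then the factorial moments determine
  \<open>E (z ^ N)\<close> for every complex \<open>z\<close>, by expanding \<open>z ^ N\<close> in powers of \<open>z - 1\<close>
  (\<open>integral_power_cong_binomial_moments\<close>). Therefore the generating functions of \<open>[\<alpha>, \<beta>]\<close> at
  \<open>L\<close> and of \<open>[1, a]\<close> at \<open>L / \<alpha>\<close> are the same function on \<open>S_pi\<close> (\<open>mgf_box_dilation\<close>).
  Everything asserted about \<open>\<Lambda>\<close>, \<open>J\<close>, \<open>C\<close> and the Szego asymptotics is the substitution of
  \<open>L / \<alpha>\<close> for \<open>L\<close> in the reference asymptotics, together with the identity theorem on the strip,
  which pins down \<open>\<Lambda>\<close> by its values on the real line.

  The large deviations principle is the Gaertner-Ellis theorem for a limit \<open>\<Lambda>\<close> that is finite and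
  differentiable on the whole real line (\<open>gaertner_ellis\<close>); here \<open>\<Lambda>\<close> is differentiable as the
  restriction of a holomorphic function. The upper bound is Chernoff's inequality and compactness.
  The lower bound tilts the law by \<open>exp (\<eta> N)\<close>, which concentrates \<open>N / L\<close> at \<open>\<Lambda>' \<eta>\<close>, so it gives
  the rate only at points of the form \<open>\<Lambda>' \<eta>\<close>; \<open>exposed_point_near\<close> shows that such points
  come arbitrarily close to every point of finite rate without a larger rate.
\<close>

section \<open>Factorial moments under dilations\<close>

lemma prod_falling_eq_fact_choose:
  "(\<Prod>i = 0..<n. N - i) = fact n * (N choose n)" for N n :: nat
proof (induction n)
  case (Suc n)
  have "(N - n) * (N choose n) = Suc n * (N choose Suc n)"
    by (metis binomial_absorb_comp binomial_absorption mult.commute)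
  with Suc show ?case
    by (simp add: algebra_simps) 
qed simp

lemma card_injective_tuples:
  assumes "finite S"
  shows "card {z \<in> {..<n} \<rightarrow>\<^sub>E S. inj_on z {..<n}} = fact n * (card S choose n)"
  using card_inj_on_subset_funcset[of "{..<n}" S "{..<n}"] assms
  by (simp add: prod_falling_eq_fact_choose)

text \<open>
  Product measures are determined by their values on boxes, so the behaviour of Lebesgue measure under
  dilations passes to finite powers of it factor by factor.
\<close>

lemma PiM_lborel_scaleR:
  fixes J :: "'i set" and c :: real
  assumes J: "finite J" and c: "0 < c"
  shows "PiM J (\<lambda>_. lborel :: 'a::euclidean_space measure) =
    density (distr (PiM J (\<lambda>_. lborel)) (PiM J (\<lambda>_. lborel)) (\<lambda>z. \<lambda>i\<in>J. c *\<^sub>R z i))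
      (\<lambda>_. ennreal (c ^ (DIM('a) * card J)))"
    (is "?P = density (distr ?P ?P ?T) _")
proof -
  interpret product_sigma_finite "\<lambda>_::'i. lborel :: 'a measure" ..
  have T: "?T \<in> measurable ?P ?P"
    by measurable
  have scale: "emeasure lborel A = ennreal (c ^ DIM('a)) * emeasure lborel ((\<lambda>x. c *\<^sub>R x) -` A)"
    if "A \<in> sets borel" for A :: "'a set"
  proof -
    have "emeasure lborel A =
      emeasure (density (distr lborel borel (\<lambda>x::'a. 0 + c *\<^sub>R x)) (\<lambda>_. \<bar>c\<bar> ^ DIM('a))) A"
      using c by (subst lborel_affine[of c 0, symmetric]) auto
    also have "\<dots> = ennreal (c ^ DIM('a)) * emeasure lborel ((\<lambda>x. c *\<^sub>R x) -` A)"
      using that c by (subst emeasure_density_const) (auto simp: emeasure_distr)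
    finally show ?thesis .
  qed
  have "density (distr ?P ?P ?T) (\<lambda>_. ennreal (c ^ (DIM('a) * card J))) = ?P"
  proof (rule PiM_eqI)
    fix A :: "'i \<Rightarrow> 'a set"
    assume A: "\<And>i. i \<in> J \<Longrightarrow> A i \<in> sets lborel"
    have vim: "(\<lambda>x. c *\<^sub>R x) -` A i \<in> sets lborel" if "i \<in> J" for i
      using measurable_sets[of "\<lambda>x::'a. c *\<^sub>R x" borel borel "A i"] A[OF that] by auto
    have PiE: "Pi\<^sub>E J A \<in> sets ?P"
      using A J by (intro sets_PiM_I_finite) auto
    have "?T -` Pi\<^sub>E J A \<inter> space ?P = Pi\<^sub>E J (\<lambda>i. (\<lambda>x. c *\<^sub>R x) -` A i)"
      by (auto simp: space_PiM PiE_iff)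
    then have "emeasure (distr ?P ?P ?T) (Pi\<^sub>E J A)
        = (\<Prod>i\<in>J. emeasure lborel ((\<lambda>x. c *\<^sub>R x) -` A i))"
      using vim J by (simp add: emeasure_distr[OF T PiE] emeasure_PiM)
    then have "emeasure (density (distr ?P ?P ?T) (\<lambda>_. ennreal (c ^ (DIM('a) * card J)))) (Pi\<^sub>E J A)
        = ennreal (c ^ (DIM('a) * card J)) * (\<Prod>i\<in>J. emeasure lborel ((\<lambda>x. c *\<^sub>R x) -` A i))"
      using PiE by (subst emeasure_density_const) auto
    also have "\<dots> = (\<Prod>i\<in>J. ennreal (c ^ DIM('a)) * emeasure lborel ((\<lambda>x. c *\<^sub>R x) -` A i))"
      using c by (simp add: prod.distrib power_mult ennreal_power)
    also have "\<dots> = (\<Prod>i\<in>J. emeasure lborel (A i))"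
      using A by (intro prod.cong) (auto simp: scale)
    finally show "emeasure (density (distr ?P ?P ?T) (\<lambda>_. ennreal (c ^ (DIM('a) * card J)))) (Pi\<^sub>E J A)
        = (\<Prod>i\<in>J. emeasure lborel (A i))" .
  qed (use J in auto)
  then show ?thesis ..
qed

lemma nn_integral_PiM_lborel_scaleR:
  fixes f :: "('i \<Rightarrow> 'a::euclidean_space) \<Rightarrow> ennreal" and c :: real
  assumes J: "finite J" and c: "0 < c"
    and f: "f \<in> borel_measurable (PiM J (\<lambda>_. lborel))"
  shows "(\<integral>\<^sup>+ z. f z \<partial>PiM J (\<lambda>_. lborel)) =
    ennreal (c ^ (DIM('a) * card J)) * (\<integral>\<^sup>+ z. f (\<lambda>i\<in>J. c *\<^sub>R z i) \<partial>PiM J (\<lambda>_. lborel))"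
    (is "integral\<^sup>N ?P f = _")
proof -
  have T: "(\<lambda>z. \<lambda>i\<in>J. c *\<^sub>R z i) \<in> measurable ?P ?P"
    by measurable
  show ?thesis
    using f T by (subst PiM_lborel_scaleR[OF J c])
      (simp add: nn_integral_density nn_integral_distr nn_integral_cmult)
qed

lemma K_H_scaleR:
  assumes "c \<noteq> 0"
  shows "K_H (c *\<^sub>R z) (c *\<^sub>R w) = of_real (inverse (c\<^sup>2)) * K_H z w"
proof -
  have "c *\<^sub>R z - cnj (c *\<^sub>R w) = of_real c * (z - cnj w)"
    by (simp add: scaleR_conv_of_real algebra_simps)
  then show ?thesis
    using assms unfolding K_H_def \<open>c *\<^sub>R z - cnj (c *\<^sub>R w) = _\<close> power_mult_distrib
    by (simp add: divide_simps)
qed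

text \<open>The \<open>n\<close>-point correlation function of the determinantal process with kernel \<open>K_H\<close>.\<close>

definition correlation_density :: "nat \<Rightarrow> (nat \<Rightarrow> complex) \<Rightarrow> ennreal" where
  "correlation_density n z =
     ennreal (Re (Determinant.det (Matrix.mat n n (\<lambda>(i, j). K_H (z i) (z j)))))"

lemma correlation_density_measurable [measurable]:
  "correlation_density n \<in> borel_measurable (PiM {..<n} (\<lambda>_. lborel))"
proof -
  have comp: "(\<lambda>z. z i) \<in> borel_measurable (PiM {..<n} (\<lambda>_. lborel :: complex measure))"
    if "i < n" for i
    using that by (metis lessThan_iff measurable_component_singleton measurable_lborel1)
  have cnj: "cnj \<in> borel_measurable borel"
    by (intro borel_measurable_continuous_onI continuous_intros)
  have K: "(\<lambda>z. K_H (z i) (z j)) \<in> borel_measurable (PiM {..<n} (\<lambda>_. lborel))"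
    if "i < n" "j < n" for i j
    unfolding K_H_def
    using comp[OF that(1)] measurable_compose[OF comp[OF that(2)] cnj] by measurable
  have det: "Determinant.det (Matrix.mat n n (\<lambda>(i, j). K_H (z i) (z j))) =
      (\<Sum>p | p permutes {0..<n}. signof p * (\<Prod>i = 0..<n. K_H (z i) (z (p i))))" for z
    by (subst det_def'[of _ n])
      (auto intro!: sum.cong prod.cong simp: permutes_in_image)
  have "(\<lambda>z. \<Sum>p | p permutes {0..<n}. signof p * (\<Prod>i = 0..<n. K_H (z i) (z (p i))))
      \<in> borel_measurable (PiM {..<n} (\<lambda>_. lborel))"
    by (intro borel_measurable_sum borel_measurable_times borel_measurable_prod K
        borel_measurable_const)
      (use permutes_in_image[of _ "{0..<n}"] in auto)
  then show ?thesis
    unfolding correlation_density_def[abs_def] det by measurable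
qed

text \<open>
  Each of the \<open>n\<close> rows of the matrix contributes a factor \<open>c\<^sup>-\<^sup>2\<close>, and \<open>c ^ (2 * n)\<close> is the Jacobian of
  the dilation of \<open>n\<close> points of the plane: the factorial moment measure is invariant.
\<close>

lemma correlation_density_scaleR:
  assumes c: "0 < c"
  shows "ennreal (c ^ (2 * n)) * correlation_density n (\<lambda>i\<in>{..<n}. c *\<^sub>R z i)
    = correlation_density n z"
proof -
  let ?A = "Matrix.mat n n (\<lambda>(i, j). K_H (z i) (z j))"
  have "Matrix.mat n n (\<lambda>(i, j). K_H ((\<lambda>i\<in>{..<n}. c *\<^sub>R z i) i) ((\<lambda>i\<in>{..<n}. c *\<^sub>R z i) j))
      = of_real (inverse (c\<^sup>2)) \<cdot>\<^sub>m ?A"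
    using c by (intro eq_matI) (auto simp: K_H_scaleR)
  then have "Re (Determinant.det (Matrix.mat n n
        (\<lambda>(i, j). K_H ((\<lambda>i\<in>{..<n}. c *\<^sub>R z i) i) ((\<lambda>i\<in>{..<n}. c *\<^sub>R z i) j))))
      = Re (of_real (inverse (c\<^sup>2) ^ n) * Determinant.det ?A)"
    by simp
  also have "\<dots> = inverse (c ^ (2 * n)) * Re (Determinant.det ?A)"
    by (simp add: power_mult power_inverse flip: of_real_power of_real_inverse)
  finally show ?thesis
    using c by (simp add: correlation_density_def mult.assoc[symmetric] flip: ennreal_mult')
qed

text \<open>
  For \<open>B = D ^ n\<close> the tuples counted by the factorial moment measure are the injective maps from
  \<open>{..<n}\<close> to the finite set \<open>Z \<omega> \<inter> D\<close>, so the measure of \<open>D ^ n\<close> is a moment of the count alone.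
\<close>

lemma factorial_moment:
  assumes Z: "determinantal_process M upper_half_plane K_H Z"
    and D: "compact D" "D \<subseteq> upper_half_plane"
  shows "(\<integral>\<^sup>+ \<omega>. of_nat (fact n * (card (Z \<omega> \<inter> D) choose n)) \<partial>M) =
    (\<integral>\<^sup>+ z. correlation_density n z * indicator (Pi\<^sub>E {..<n} (\<lambda>_. D)) z \<partial>PiM {..<n} (\<lambda>_. lborel))"
proof -
  have fin: "finite (Z \<omega> \<inter> D)" if "\<omega> \<in> space M" for \<omega>
    using Z D that by (auto simp: determinantal_process_def simple_point_process_def)
  have B: "Pi\<^sub>E {..<n} (\<lambda>_. D) \<in> sets (PiM {..<n} (\<lambda>_. lborel))"
    using D by (intro sets_PiM_I_finite) (auto intro: borel_compact)
  have "emeasure (count_space UNIV)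
      {z \<in> Pi\<^sub>E {..<n} (\<lambda>_. D). inj_on z {..<n} \<and> (\<forall>i<n. z i \<in> Z \<omega>)}
      = of_nat (fact n * (card (Z \<omega> \<inter> D) choose n))" if "\<omega> \<in> space M" for \<omega>
  proof -
    have eq: "{z \<in> Pi\<^sub>E {..<n} (\<lambda>_. D). inj_on z {..<n} \<and> (\<forall>i<n. z i \<in> Z \<omega>)}
      = {z \<in> {..<n} \<rightarrow>\<^sub>E Z \<omega> \<inter> D. inj_on z {..<n}}"
      by (auto simp: PiE_iff)
    have "finite {z \<in> {..<n} \<rightarrow>\<^sub>E Z \<omega> \<inter> D. inj_on z {..<n}}"
      by (rule finite_subset[OF Collect_restrict]) (intro finite_PiE finite_lessThan fin that)
    then show ?thesis
      unfolding eq card_injective_tuples[OF fin[OF that], symmetric]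
      by (intro emeasure_count_space_finite) simp_all
  qed
  then have "(\<integral>\<^sup>+ \<omega>. of_nat (fact n * (card (Z \<omega> \<inter> D) choose n)) \<partial>M)
      = (\<integral>\<^sup>+ \<omega>. emeasure (count_space UNIV)
      {z \<in> Pi\<^sub>E {..<n} (\<lambda>_. D). inj_on z {..<n} \<and> (\<forall>i<n. z i \<in> Z \<omega>)} \<partial>M)"
    by (intro nn_integral_cong) (rule sym)
  also have "\<dots> = (\<integral>\<^sup>+ z \<in> Pi\<^sub>E {..<n} (\<lambda>_. D). correlation_density n z \<partial>PiM {..<n} (\<lambda>_. lborel))"
    unfolding correlation_density_def
    by (rule Z[unfolded determinantal_process_def, THEN conjunct2, THEN spec, THEN bspec, OF B,
          THEN mp]) (intro PiE_mono D(2))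
  finally show ?thesis .
qed

lemma factorial_moment_dilation:
  assumes Z: "determinantal_process M upper_half_plane K_H Z"
    and D: "compact D" "D \<subseteq> upper_half_plane" and c: "0 < c"
  shows "(\<integral>\<^sup>+ \<omega>. of_nat (fact n * (card (Z \<omega> \<inter> (\<lambda>z. c *\<^sub>R z) ` D) choose n)) \<partial>M) =
    (\<integral>\<^sup>+ \<omega>. of_nat (fact n * (card (Z \<omega> \<inter> D) choose n)) \<partial>M)"
proof -
  let ?P = "PiM {..<n} (\<lambda>_. lborel :: complex measure)"
  let ?T = "\<lambda>z. \<lambda>i\<in>{..<n}. c *\<^sub>R z i :: complex"
  let ?D = "(\<lambda>z. c *\<^sub>R z) ` D"
  have cD: "compact ?D" "?D \<subseteq> upper_half_plane"
    using D c by (auto simp: compact_scaling upper_half_plane_def)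
  have box: "Pi\<^sub>E {..<n} (\<lambda>_. ?D) \<in> sets ?P"
    using cD by (intro sets_PiM_I_finite) (auto intro: borel_compact)
  have T: "?T \<in> measurable ?P ?P"
    by measurable
  have ind: "indicator (Pi\<^sub>E {..<n} (\<lambda>_. ?D)) (?T z)
      = (indicator (Pi\<^sub>E {..<n} (\<lambda>_. D)) z :: ennreal)" if "z \<in> space ?P" for z
  proof -
    have "c *\<^sub>R z i \<in> ?D \<longleftrightarrow> z i \<in> D" for i
      using c by auto
    then have "?T z \<in> Pi\<^sub>E {..<n} (\<lambda>_. ?D) \<longleftrightarrow> z \<in> Pi\<^sub>E {..<n} (\<lambda>_. D)"
      using that by (simp add: space_PiM PiE_iff)
    then show ?thesis
      by (simp add: indicator_def)
  qed
  have "(\<integral>\<^sup>+ z. correlation_density n z * indicator (Pi\<^sub>E {..<n} (\<lambda>_. ?D)) z \<partial>?P)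
      = ennreal (c ^ (2 * n)) * (\<integral>\<^sup>+ z. correlation_density n (?T z)
          * indicator (Pi\<^sub>E {..<n} (\<lambda>_. ?D)) (?T z) \<partial>?P)"
    using box by (subst nn_integral_PiM_lborel_scaleR[OF _ c]) simp_all
  also have "\<dots> = (\<integral>\<^sup>+ z. ennreal (c ^ (2 * n)) * (correlation_density n (?T z)
          * indicator (Pi\<^sub>E {..<n} (\<lambda>_. ?D)) (?T z)) \<partial>?P)"
    by (intro nn_integral_cmult[symmetric] borel_measurable_times_ennreal
        measurable_compose[OF T] borel_measurable_indicator box correlation_density_measurable)
  also have "\<dots> = (\<integral>\<^sup>+ z. correlation_density n z * indicator (Pi\<^sub>E {..<n} (\<lambda>_. D)) z \<partial>?P)"
    by (intro nn_integral_cong)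
      (simp only: ind mult.assoc[symmetric] correlation_density_scaleR[OF c])
  finally show ?thesis
    by (simp only: factorial_moment[OF Z cD] factorial_moment[OF Z D])
qed

section \<open>Generating functions from binomial moments\<close>

lemma binomial_sums:
  fixes w :: "'a::{real_normed_field}"
  shows "(\<lambda>n. of_nat (N choose n) * w ^ n) sums (1 + w) ^ N"
proof -
  have "(\<lambda>n. of_nat (N choose n) * w ^ n) sums (\<Sum>n\<le>N. of_nat (N choose n) * w ^ n)"
    by (rule sums_finite) (auto simp: binomial_eq_0)
  also have "(\<Sum>n\<le>N. of_nat (N choose n) * w ^ n) = (1 + w) ^ N"
    using binomial_ring[of w 1 N] by (simp add: add.commute)
  finally show ?thesis .
qed

text \<open>
  The binomial series of \<open>(1 + r) ^ X\<close> has nonnegative terms, so it may be integrated termwise even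
  before anything is known to be finite. This transports finiteness of exponential moments between
  variables with the same binomial moments.
\<close>

lemma nn_integral_power_eq_binomial_moments:
  fixes X :: "'w \<Rightarrow> nat"
  assumes X[measurable]: "X \<in> measurable M (count_space UNIV)" and r: "0 \<le> r"
  shows "(\<integral>\<^sup>+ \<omega>. ennreal ((1 + r) ^ X \<omega>) \<partial>M) =
    (\<Sum>n. ennreal (r ^ n) * (\<integral>\<^sup>+ \<omega>. of_nat (X \<omega> choose n) \<partial>M))"
proof -
  have "ennreal ((1 + r) ^ N) = (\<Sum>n. ennreal (r ^ n) * of_nat (N choose n))" for N
  proof -
    have "(\<Sum>n. ennreal (of_nat (N choose n) * r ^ n)) = ennreal ((1 + r) ^ N)"
      using binomial_sums[of N r] r by (subst suminf_ennreal2) (auto simp: sums_iff)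
    then show ?thesis
      using r by (simp add: ennreal_mult mult.commute ennreal_of_nat_eq_real_of_nat)
  qed
  then have "(\<integral>\<^sup>+ \<omega>. ennreal ((1 + r) ^ X \<omega>) \<partial>M)
      = (\<integral>\<^sup>+ \<omega>. (\<Sum>n. ennreal (r ^ n) * of_nat (X \<omega> choose n)) \<partial>M)"
    by simp
  also have "\<dots> = (\<Sum>n. \<integral>\<^sup>+ \<omega>. ennreal (r ^ n) * of_nat (X \<omega> choose n) \<partial>M)"
    by (intro nn_integral_suminf) measurable
  also have "\<dots> = (\<Sum>n. ennreal (r ^ n) * (\<integral>\<^sup>+ \<omega>. of_nat (X \<omega> choose n) \<partial>M))"
    by (intro suminf_cong nn_integral_cmult) measurable
  finally show ?thesis .
qed

text \<open>
  Once the moments of \<open>(1 + r) ^ X\<close> are finite, the one with \<open>r = norm (z - 1)\<close> dominates the binomial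
  series of \<open>z ^ X = (1 + (z - 1)) ^ X\<close>. The expansion at \<open>1\<close> converges for all \<open>z\<close>, so it reaches
  every value \<open>z = exp \<theta>\<close>.
\<close>

lemma integral_power_eq_binomial_moments:
  fixes X :: "'w \<Rightarrow> nat" and z :: complex
  assumes X[measurable]: "X \<in> measurable M (count_space UNIV)"
    and fin: "\<And>r. 0 \<le> r \<Longrightarrow> (\<integral>\<^sup>+ \<omega>. ennreal ((1 + r) ^ X \<omega>) \<partial>M) < \<infinity>"
  shows "(\<integral>\<omega>. z ^ X \<omega> \<partial>M) =
    (\<Sum>n. of_real (enn2real (\<integral>\<^sup>+ \<omega>. of_nat (X \<omega> choose n) \<partial>M)) * (z - 1) ^ n)"
proof -
  define r where "r = norm (z - 1)"
  define b where "b n = (\<integral>\<^sup>+ \<omega>. of_nat (X \<omega> choose n) \<partial>M)" for n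
  have r: "0 \<le> r"
    by (simp add: r_def)
  have b_fin: "b n < \<infinity>" for n
  proof -
    \<comment> \<open>A binomial coefficient is at most \<open>2 ^ X\<close>, the case \<open>r = 1\<close> of the hypothesis.\<close>
    have "b n \<le> (\<integral>\<^sup>+ \<omega>. ennreal ((1 + 1) ^ X \<omega>) \<partial>M)"
      unfolding b_def using binomial_le_pow2
      by (intro nn_integral_mono)
        (metis ennreal_leI ennreal_of_nat_eq_real_of_nat of_nat_le_iff of_nat_numeral of_nat_power one_add_one)
    then show ?thesis
      using fin[of 1] by (simp add: order_le_less_trans)
  qed
  have int: "integrable M (\<lambda>\<omega>. real (X \<omega> choose n))" for n
    using b_fin[of n] unfolding b_def
    by (intro integrableI_bounded) (auto simp: ennreal_of_nat_eq_real_of_nat)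
  have b: "(\<integral>\<omega>. real (X \<omega> choose n) \<partial>M) = enn2real (b n)" for n
    unfolding b_def by (subst integral_eq_nn_integral) (auto simp: ennreal_of_nat_eq_real_of_nat)
  have norm: "norm (of_nat (X \<omega> choose n) * (z - 1) ^ n) = real (X \<omega> choose n) * r ^ n" for \<omega> n
    by (simp add: norm_mult norm_power r_def)
  have "(\<Sum>n. ennreal (enn2real (b n) * r ^ n)) = (\<Sum>n. ennreal (r ^ n) * b n)"
    using b_fin r by (intro suminf_cong) (simp add: ennreal_mult mult.commute)
  also have "\<dots> < \<infinity>"
    using fin[OF r] unfolding b_def nn_integral_power_eq_binomial_moments[OF X r] .
  finally have summ: "summable (\<lambda>n. enn2real (b n) * r ^ n)"
    using r by (intro summable_suminf_not_top) auto
  have "(\<integral>\<omega>. z ^ X \<omega> \<partial>M) = (\<integral>\<omega>. (\<Sum>n. of_nat (X \<omega> choose n) * (z - 1) ^ n) \<partial>M)"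
    using binomial_sums[of _ "z - 1"] by (intro Bochner_Integration.integral_cong) (auto simp: sums_iff)
  also have "\<dots> = (\<Sum>n. \<integral>\<omega>. of_nat (X \<omega> choose n) * (z - 1) ^ n \<partial>M)"
  proof (rule integral_suminf)
    show "integrable M (\<lambda>\<omega>. of_nat (X \<omega> choose n) * (z - 1) ^ n)" for n
      using integrable_of_real[OF int[of n], where 'a=complex]
      by (intro integrable_mult_left) simp
    show "AE \<omega> in M. summable (\<lambda>n. norm (of_nat (X \<omega> choose n) * (z - 1) ^ n))"
      unfolding norm using binomial_sums[of _ r] by (auto simp: sums_iff)
    show "summable (\<lambda>n. \<integral>\<omega>. norm (of_nat (X \<omega> choose n) * (z - 1) ^ n) \<partial>M)"
      unfolding norm using summ by (simp add: b)
  qed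
  also have "\<dots> = (\<Sum>n. of_real (enn2real (b n)) * (z - 1) ^ n)"
    by (intro suminf_cong) (simp flip: b integral_complex_of_real)
  finally show ?thesis
    unfolding b_def .
qed

lemma integral_power_cong_binomial_moments:
  fixes X Y :: "'w \<Rightarrow> nat" and z :: complex
  assumes X: "X \<in> measurable M (count_space UNIV)" and Y: "Y \<in> measurable M (count_space UNIV)"
    and moments: "\<And>n. (\<integral>\<^sup>+ \<omega>. of_nat (X \<omega> choose n) \<partial>M) = (\<integral>\<^sup>+ \<omega>. of_nat (Y \<omega> choose n) \<partial>M)"
    and fin: "\<And>r. 0 \<le> r \<Longrightarrow> (\<integral>\<^sup>+ \<omega>. ennreal ((1 + r) ^ Y \<omega>) \<partial>M) < \<infinity>"
  shows "(\<integral>\<omega>. z ^ X \<omega> \<partial>M) = (\<integral>\<omega>. z ^ Y \<omega> \<partial>M)"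
proof -
  have "(\<integral>\<^sup>+ \<omega>. ennreal ((1 + r) ^ X \<omega>) \<partial>M) < \<infinity>" if "0 \<le> r" for r
    using fin[OF that] that
    by (simp only: nn_integral_power_eq_binomial_moments[OF X]
        nn_integral_power_eq_binomial_moments[OF Y] moments)
  then show ?thesis
    using fin moments
    by (simp add: integral_power_eq_binomial_moments[OF X] integral_power_eq_binomial_moments[OF Y])
qed

section \<open>Counts in boxes\<close>

definition strip_box :: "real set \<Rightarrow> real \<Rightarrow> complex set" where
  "strip_box I L = {z. 0 \<le> Re z \<and> Re z \<le> L \<and> Im z \<in> I}"

lemma box_count_eq_card_strip_box: "box_count Z I L \<omega> = card (Z \<omega> \<inter> strip_box I L)"
  by (auto simp: box_count_def strip_box_def intro: arg_cong[where f = card])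

lemma compact_strip_box: "compact (strip_box {u..v} L)"
proof -
  have "strip_box {u..v} L = cbox (Complex 0 u) (Complex L v)"
    by (auto simp: strip_box_def in_cbox_complex_iff)
  then show ?thesis
    by simp
qed

lemma strip_box_subset: "0 < u \<Longrightarrow> strip_box {u..v} L \<subseteq> upper_half_plane"
  by (auto simp: strip_box_def upper_half_plane_def)

lemma scaleR_strip_box:
  assumes c: "0 < c"
  shows "(\<lambda>z. c *\<^sub>R z) ` strip_box {1..a} (L / c) = strip_box {c..c * a} L"
proof (intro equalityI subsetI)
  fix z assume "z \<in> strip_box {c..c * a} L"
  then have "(1 / c) *\<^sub>R z \<in> strip_box {1..a} (L / c)"
    using c by (auto simp: strip_box_def field_simps)
  moreover have "z = c *\<^sub>R ((1 / c) *\<^sub>R z)"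
    using c by simp
  ultimately show "z \<in> (\<lambda>z. c *\<^sub>R z) ` strip_box {1..a} (L / c)"
    by blast
qed (use c in \<open>auto simp: strip_box_def field_simps\<close>)

lemma box_count_measurable:
  assumes Z: "determinantal_process M upper_half_plane K_H Z" and u: "0 < u"
  shows "box_count Z {u..v} L \<in> measurable M (count_space UNIV)"
proof -
  have "strip_box {u..v} L \<in> sets borel"
    using compact_strip_box by (rule borel_compact)
  moreover have "\<forall>D C. D \<in> sets borel \<and> compact C \<and> C \<subseteq> upper_half_plane \<and> D \<subseteq> C \<longrightarrow>
      (\<lambda>\<omega>. card (Z \<omega> \<inter> D)) \<in> measurable M (count_space UNIV)"
    by (rule Z[unfolded determinantal_process_def simple_point_process_def,
          THEN conjunct1, THEN conjunct2, THEN conjunct2])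
  ultimately have "(\<lambda>\<omega>. card (Z \<omega> \<inter> strip_box {u..v} L)) \<in> measurable M (count_space UNIV)"
    using compact_strip_box[of u v L] strip_box_subset[OF u, of v L] by blast
  then show ?thesis
    unfolding box_count_eq_card_strip_box[abs_def] .
qed

lemma complex_of_real_moment:
  "of_real (\<integral>\<omega>. exp (\<theta> * real (box_count Z I L \<omega>)) \<partial>M) = mgf M Z I L (of_real \<theta>)"
  unfolding mgf_def by (simp flip: integral_complex_of_real exp_of_real)

text \<open>
  An exponential has no zero, and the Bochner integral of a function that is not integrable is \<open>0\<close>: the
  existence of a logarithm is what makes the exponential moments finite.
\<close>

lemma is_log_mgf_imp_integrable:
  assumes "is_log_mgf M Z I L g"
  shows "integrable M (\<lambda>\<omega>. exp (\<theta> * real (box_count Z I L \<omega>)))"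
proof (rule ccontr)
  assume "\<not> ?thesis"
  then have "mgf M Z I L (of_real \<theta>) = 0"
    by (simp add: not_integrable_integral_eq flip: complex_of_real_moment)
  moreover have "of_real \<theta> \<in> S_pi"
    by (simp add: S_pi_def)
  ultimately show False
    using assms unfolding is_log_mgf_def by (metis exp_not_eq_zero)
qed

text \<open>
  The box on the left is the dilate by \<open>c\<close> of the box on the right, so the two counts have the same
  factorial moments. A logarithm for the right-hand side makes \<open>(1 + r) ^ N\<close> integrable for all
  \<open>r \<ge> 0\<close>, with \<open>\<theta> = ln (1 + r)\<close>, which is what lets these moments determine the generating function.
\<close>

lemma mgf_box_dilation:
  assumes Z: "determinantal_process M upper_half_plane K_H Z"
    and c: "0 < c" and log: "is_log_mgf M Z {1..a} (L / c) g"
  shows "mgf M Z {c..c * a} L = mgf M Z {1..a} (L / c)"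
proof
  fix \<theta> :: complex
  let ?X = "box_count Z {c..c * a} L" and ?Y = "box_count Z {1..a} (L / c)"
  have X: "?X \<in> measurable M (count_space UNIV)"
    using Z c by (rule box_count_measurable)
  have Y: "?Y \<in> measurable M (count_space UNIV)"
    using Z by (rule box_count_measurable) simp
  have fact_out: "(\<integral>\<^sup>+ \<omega>. of_nat (fact n * (V \<omega> choose n)) \<partial>M)
      = of_nat (fact n) * (\<integral>\<^sup>+ \<omega>. of_nat (V \<omega> choose n) \<partial>M)"
    if V[measurable]: "V \<in> measurable M (count_space UNIV)" for V :: "'a \<Rightarrow> nat" and n
    unfolding of_nat_mult by (intro nn_integral_cmult) measurable
  have moments: "(\<integral>\<^sup>+ \<omega>. of_nat (?X \<omega> choose n) \<partial>M) = (\<integral>\<^sup>+ \<omega>. of_nat (?Y \<omega> choose n) \<partial>M)" for n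
  proof -
    have "(\<integral>\<^sup>+ \<omega>. of_nat (fact n * (?X \<omega> choose n)) \<partial>M)
        = (\<integral>\<^sup>+ \<omega>. of_nat (fact n * (?Y \<omega> choose n)) \<partial>M)"
      unfolding box_count_eq_card_strip_box scaleR_strip_box[OF c, symmetric]
      by (intro factorial_moment_dilation[OF Z compact_strip_box strip_box_subset c]) simp
    then have "of_nat (fact n) * (\<integral>\<^sup>+ \<omega>. of_nat (?X \<omega> choose n) \<partial>M)
        = (of_nat (fact n) :: ennreal) * (\<integral>\<^sup>+ \<omega>. of_nat (?Y \<omega> choose n) \<partial>M)"
      by (simp only: fact_out[OF X] fact_out[OF Y])
    then show ?thesis
      by (subst (asm) ennreal_mult_cancel_left) (auto simp: ennreal_of_nat_eq_real_of_nat)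
  qed
  have fin: "(\<integral>\<^sup>+ \<omega>. ennreal ((1 + r) ^ ?Y \<omega>) \<partial>M) < \<infinity>" if r: "0 \<le> r" for r :: real
  proof -
    have "exp (ln (1 + r) * real (?Y \<omega>)) = (1 + r) ^ ?Y \<omega>" for \<omega>
      using r by (simp add: exp_of_nat2_mult)
    then have "integrable M (\<lambda>\<omega>. (1 + r) ^ ?Y \<omega>)"
      using is_log_mgf_imp_integrable[OF log, of "ln (1 + r)"] by simp
    then show ?thesis
      using r by (simp add: integrable_iff_bounded)
  qed
  show "mgf M Z {c..c * a} L \<theta> = mgf M Z {1..a} (L / c) \<theta>"
    unfolding mgf_def exp_of_nat2_mult
    by (rule integral_power_cong_binomial_moments[OF X Y moments fin])
qed

section \<open>Holomorphic extension to the strip\<close>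

lemma open_S_pi: "open S_pi"
  unfolding S_pi_def by (intro open_Collect_less continuous_intros)

lemma connected_S_pi: "connected S_pi"
proof -
  have "S_pi = {z. Im z < pi} \<inter> {z. - pi < Im z}"
    by (auto simp: S_pi_def)
  moreover have "convex ({z. Im z < pi} \<inter> {z. Im z > - pi})"
    by (intro convex_Int convex_halfspace_Im_lt convex_halfspace_Im_gt)
  ultimately have "convex S_pi"
    by simp
  then show ?thesis
    by (rule convex_connected)
qed

lemma of_real_in_S_pi: "of_real x \<in> S_pi"
  by (simp add: S_pi_def)

lemma holomorphic_on_S_pi_eqI:
  assumes "f holomorphic_on S_pi" "g holomorphic_on S_pi"
    and eq: "\<And>x::real. f (of_real x) = g (of_real x)" and \<theta>: "\<theta> \<in> S_pi"
  shows "f \<theta> = g \<theta>"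
proof -
  have lim: "(0::complex) islimpt range of_real"
    unfolding islimpt_approachable
  proof (intro allI impI)
    fix e :: real assume "0 < e"
    then show "\<exists>x'\<in>range of_real. x' \<noteq> (0::complex) \<and> dist x' 0 < e"
      by (intro bexI[of _ "of_real (e / 2)"] rangeI) auto
  qed
  have "(\<lambda>z. f z - g z) \<theta> = 0"
  proof (rule analytic_continuation[OF _ open_S_pi connected_S_pi _ _ lim _ \<theta>])
    show "(\<lambda>z. f z - g z) holomorphic_on S_pi"
      using assms by (intro holomorphic_intros)
    show "(0::complex) \<in> S_pi"
      by (simp add: S_pi_def)
  qed (auto simp: of_real_in_S_pi eq)
  then show ?thesis
    by simp
qed

lemma real_derivative_of_holomorphic:
  fixes l :: "real \<Rightarrow> real"
  assumes g: "g holomorphic_on S_pi" and eq: "\<And>x. g (of_real x) = of_real (l x)"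
  shows "(l has_real_derivative Re (deriv g (of_real x))) (at x)"
proof -
  have "(g has_field_derivative deriv g (of_real x)) (at (of_real x))"
    using g open_S_pi of_real_in_S_pi by (rule holomorphic_derivI)
  then have "((\<lambda>x. g (of_real x)) has_vector_derivative deriv g (of_real x)) (at x)"
    by (rule has_vector_derivative_real_field)
  then have "((\<lambda>x. Re (g (of_real x))) has_vector_derivative Re (deriv g (of_real x))) (at x)"
    by (rule bounded_linear.has_vector_derivative[OF bounded_linear_Re])
  then show ?thesis
    by (simp add: eq has_real_derivative_iff_has_vector_derivative)
qed

text \<open>
  The choice in the definition of \<open>Lambda\<close> is harmless: a holomorphic function on the strip is
  determined by its restriction to the real line, so on the strip any holomorphic
  extension of \<open>Lambda_real\<close> is the one chosen.
\<close>

lemma Lambda_eqI: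
  assumes hol: "g holomorphic_on S_pi"
    and eq: "\<And>x::real. g (of_real x) = of_real (Lambda_real M Z I x)"
  shows "Lambda M Z I holomorphic_on S_pi"
    and "Lambda M Z I (of_real x) = of_real (Lambda_real M Z I x)"
    and "\<theta> \<in> S_pi \<Longrightarrow> Lambda M Z I \<theta> = g \<theta>"
proof -
  have "\<exists>g. g holomorphic_on S_pi \<and> (\<forall>x::real. g (of_real x) = of_real (Lambda_real M Z I x))"
    using hol eq by blast
  from someI_ex[OF this] show *: "Lambda M Z I holomorphic_on S_pi"
    and **: "Lambda M Z I (of_real x) = of_real (Lambda_real M Z I x)" for x
    by (simp_all add: Lambda_def)
  show "\<theta> \<in> S_pi \<Longrightarrow> Lambda M Z I \<theta> = g \<theta>"
    using * hol by (rule holomorphic_on_S_pi_eqI) (simp_all add: ** eq)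
qed

section \<open>Rescaling the limits\<close>

text \<open>
  Two sets of heights whose generating functions agree after rescaling the length. All the limiting
  objects are functionals of the generating function, so those of \<open>I\<close> follow from those of \<open>I'\<close>.
\<close>

locale mgf_dilation =
  fixes M :: "'w measure" and Z :: "'w \<Rightarrow> complex set" and I I' :: "real set" and c :: real
  assumes c: "0 < c"
    and mgf_eq: "0 < L \<Longrightarrow> mgf M Z I L = mgf M Z I' (L / c)"
    and ref: "limits_exist M Z I'"
begin

lemma rescale: "filterlim (\<lambda>L::real. L / c) at_top at_top"
  using filterlim_tendsto_pos_mult_at_top[OF tendsto_const _ filterlim_ident, of "1 / c"] c by simp

lemma moment_eq:
  assumes "0 < L"
  shows "(\<integral>\<omega>. exp (\<theta> * real (box_count Z I L \<omega>)) \<partial>M)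
    = (\<integral>\<omega>. exp (\<theta> * real (box_count Z I' (L / c) \<omega>)) \<partial>M)"
proof -
  have "complex_of_real (\<integral>\<omega>. exp (\<theta> * real (box_count Z I L \<omega>)) \<partial>M)
      = of_real (\<integral>\<omega>. exp (\<theta> * real (box_count Z I' (L / c) \<omega>)) \<partial>M)"
    by (simp only: complex_of_real_moment mgf_eq[OF assms])
  then show ?thesis
    by (simp only: of_real_eq_iff)
qed

lemma log_mgf_eq: "0 < L \<Longrightarrow> log_mgf M Z I L = log_mgf M Z I' (L / c)"
  by (simp add: log_mgf_def is_log_mgf_def mgf_eq)

lemma is_log_mgf:
  assumes "0 < L"
  shows "is_log_mgf M Z I L (log_mgf M Z I L)"
proof -
  have "is_log_mgf M Z I' (L / c) (log_mgf M Z I' (L / c))"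
    using ref assms c by (simp add: limits_exist_def)
  then show ?thesis
    unfolding is_log_mgf_def log_mgf_eq[OF assms] mgf_eq[OF assms] .
qed

lemma cumulant_limit:
  "((\<lambda>L. ln (\<integral>\<omega>. exp (\<theta> * real (box_count Z I L \<omega>)) \<partial>M) / L)
      \<longlongrightarrow> Lambda_real M Z I' \<theta> / c) at_top"
proof -
  have "((\<lambda>L. ln (\<integral>\<omega>. exp (\<theta> * real (box_count Z I' L \<omega>)) \<partial>M) / L)
      \<longlongrightarrow> Lambda_real M Z I' \<theta>) at_top"
    using ref unfolding limits_exist_def by blast
  from tendsto_divide[OF filterlim_compose[OF this rescale] tendsto_const[of c]] c
  have "((\<lambda>L. ln (\<integral>\<omega>. exp (\<theta> * real (box_count Z I' (L / c) \<omega>)) \<partial>M) / (L / c) / c)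
      \<longlongrightarrow> Lambda_real M Z I' \<theta> / c) at_top"
    by simp
  then show ?thesis
  proof (rule Lim_transform_eventually)
    show "\<forall>\<^sub>F L in at_top. ln (\<integral>\<omega>. exp (\<theta> * real (box_count Z I' (L / c) \<omega>)) \<partial>M) / (L / c) / c
        = ln (\<integral>\<omega>. exp (\<theta> * real (box_count Z I L \<omega>)) \<partial>M) / L"
      using eventually_gt_at_top[of 0] by eventually_elim (use c in \<open>simp add: moment_eq\<close>)
  qed
qed

lemma Lambda_real_eq: "Lambda_real M Z I \<theta> = Lambda_real M Z I' \<theta> / c"
  unfolding Lambda_real_def[of M Z I] by (rule tendsto_Lim[OF _ cumulant_limit]) simp

lemma Lambda_rescaled_holomorphic:
  "(\<lambda>\<theta>. of_real (1 / c) * Lambda M Z I' \<theta>) holomorphic_on S_pi"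
  using ref unfolding limits_exist_def by (intro holomorphic_intros) auto

lemma Lambda_rescaled_real:
  "of_real (1 / c) * Lambda M Z I' (of_real x) = of_real (Lambda_real M Z I x)" for x :: real
  using ref unfolding limits_exist_def by (simp add: Lambda_real_eq)

lemmas Lambda_holomorphic = Lambda_eqI(1)[OF Lambda_rescaled_holomorphic Lambda_rescaled_real]
lemmas Lambda_of_real = Lambda_eqI(2)[OF Lambda_rescaled_holomorphic Lambda_rescaled_real]
lemmas Lambda_eq = Lambda_eqI(3)[OF Lambda_rescaled_holomorphic Lambda_rescaled_real]

text \<open>
  The factor \<open>1 / c\<close> in \<open>Lambda\<close> is absorbed by the change of length, so the correction term after
  the leading order is the same function, evaluated at \<open>L / c\<close>.
\<close>

lemma centred_log_mgf_eq:
  assumes "0 < L" and "\<theta> \<in> S_pi"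
  shows "log_mgf M Z I L \<theta> - of_real L * Lambda M Z I \<theta>
    = log_mgf M Z I' (L / c) \<theta> - of_real (L / c) * Lambda M Z I' \<theta>"
  using assms by (simp add: log_mgf_eq Lambda_eq)

lemma centred_log_mgf_tendsto:
  assumes \<theta>: "\<theta> \<in> S_pi"
  shows "((\<lambda>L. log_mgf M Z I L \<theta> - of_real L * Lambda M Z I \<theta>) \<longlongrightarrow> szego_C M Z I' \<theta>) at_top"
proof -
  have "((\<lambda>L. log_mgf M Z I' L \<theta> - of_real L * Lambda M Z I' \<theta>) \<longlongrightarrow> szego_C M Z I' \<theta>) at_top"
    using ref \<theta> unfolding limits_exist_def by blast
  from filterlim_compose[OF this rescale] show ?thesis
    by (rule Lim_transform_eventually)
      (use eventually_gt_at_top[of 0] in \<open>eventually_elim, simp only: centred_log_mgf_eq[OF _ \<theta>]\<close>)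
qed

lemma szego_C_eq: "\<theta> \<in> S_pi \<Longrightarrow> szego_C M Z I \<theta> = szego_C M Z I' \<theta>"
  unfolding szego_C_def[of M Z I] by (rule tendsto_Lim[OF _ centred_log_mgf_tendsto]) simp_all

lemma limits_exist: "limits_exist M Z I"
  unfolding limits_exist_def
  using is_log_mgf cumulant_limit Lambda_holomorphic Lambda_of_real centred_log_mgf_tendsto
  by (simp add: Lambda_real_eq szego_C_eq)

lemma szego_locally_uniform:
  assumes "szego_locally_uniform M Z I'"
  shows "szego_locally_uniform M Z I"
  unfolding szego_locally_uniform_def uniform_limit_iff
proof (intro allI impI)
  fix C :: "complex set" and e :: real
  assume C: "compact C \<and> C \<subseteq> S_pi" and "0 < e"
  then have "\<forall>\<^sub>F L in at_top. \<forall>\<theta>\<in>C.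
      dist (log_mgf M Z I' L \<theta> - of_real L * Lambda M Z I' \<theta>) (szego_C M Z I' \<theta>) < e"
    using assms unfolding szego_locally_uniform_def uniform_limit_iff by blast
  from eventually_compose_filterlim[OF this rescale] eventually_gt_at_top[of 0]
  show "\<forall>\<^sub>F L in at_top. \<forall>\<theta>\<in>C.
      dist (log_mgf M Z I L \<theta> - of_real L * Lambda M Z I \<theta>) (szego_C M Z I \<theta>) < e"
  proof eventually_elim
    case (elim L)
    show ?case
    proof
      fix \<theta> assume "\<theta> \<in> C"
      moreover from this C have "\<theta> \<in> S_pi"
        by blast
      ultimately show "dist (log_mgf M Z I L \<theta> - of_real L * Lambda M Z I \<theta>) (szego_C M Z I \<theta>) < e"
        using elim by (simp only: centred_log_mgf_eq szego_C_eq)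
    qed
  qed
qed

lemma rate_J_eq: "rate_J M Z I x = ereal (1 / c) * rate_J M Z I' (c * x)"
proof -
  have "rate_J M Z I x = (SUP \<theta>. ereal (1 / c) * ereal (\<theta> * (c * x) - Lambda_real M Z I' \<theta>))"
    using c by (simp add: rate_J_def Lambda_real_eq field_simps)
  also have "\<dots> = ereal (1 / c) * rate_J M Z I' (c * x)"
    unfolding rate_J_def using c by (intro Sup_ereal_mult_left'[symmetric]) auto
  finally show ?thesis .
qed

end

section \<open>Large deviations from differentiable cumulants\<close>

lemma log_prob_div_less_iff:
  assumes "0 < L"
  shows "log_prob p / ereal L < ereal c \<longleftrightarrow> (p = 0 \<or> ln p < c * L)"
  using assms by (auto simp: log_prob_def divide_simps)

lemma log_prob_div_greater_iff:
  assumes "0 < L"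
  shows "ereal c < log_prob p / ereal L \<longleftrightarrow> (p \<noteq> 0 \<and> c * L < ln p)"
  using assms by (auto simp: log_prob_def divide_simps)

lemma legendre_lower_semicontinuous:
  fixes \<Lambda> :: "real \<Rightarrow> real"
  assumes "ereal c < (SUP \<theta>. ereal (\<theta> * x - \<Lambda> \<theta>))"
  shows "\<forall>\<^sub>F y in nhds x. ereal c < (SUP \<theta>. ereal (\<theta> * y - \<Lambda> \<theta>))"
proof -
  from assms obtain \<theta> where \<theta>: "c < \<theta> * x - \<Lambda> \<theta>"
    by (auto simp: less_SUP_iff)
  have "((\<lambda>y. \<theta> * y - \<Lambda> \<theta>) \<longlongrightarrow> \<theta> * x - \<Lambda> \<theta>) (nhds x)"
    by (intro tendsto_intros filterlim_ident)
  then have "\<forall>\<^sub>F y in nhds x. c < \<theta> * y - \<Lambda> \<theta>"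
    using \<theta> by (rule order_tendstoD)
  then show ?thesis
    by eventually_elim (auto simp: less_SUP_iff)
qed

lemma legendre_good_rate_function:
  fixes \<Lambda> :: "real \<Rightarrow> real"
  shows "good_rate_function (\<lambda>x. SUP \<theta>. ereal (\<theta> * x - \<Lambda> \<theta>))" (is "good_rate_function ?J")
  unfolding good_rate_function_def
proof (intro conjI ballI allI)
  fix x :: real
  show "?J x \<le> Liminf (at x within {0..}) ?J"
    unfolding le_Liminf_iff
  proof (intro allI impI)
    fix y assume y: "y < ?J x"
    then obtain c where c: "y < ereal c" "ereal c < ?J x"
      using ereal_dense2[OF y] by auto
    have "\<forall>\<^sub>F u in at x within {0..}. ereal c < ?J u"
      using legendre_lower_semicontinuous[OF c(2)]
      unfolding eventually_at_filter by (rule eventually_mono) simp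
    then show "\<forall>\<^sub>F u in at x within {0..}. y < ?J u"
      by (rule eventually_mono) (rule less_trans[OF c(1)])
  qed
next
  fix c :: real
  have eq: "{x \<in> {0..}. ?J x \<le> ereal c} = {0..} \<inter> (\<Inter>\<theta>. {x. \<theta> * x - \<Lambda> \<theta> \<le> c})"
    by (auto simp: SUP_le_iff)
  have "closed {x \<in> {0..}. ?J x \<le> ereal c}"
    unfolding eq by (intro closed_Int closed_INT ballI closed_Collect_le continuous_intros closed_atLeast)
  moreover have "{x \<in> {0..}. ?J x \<le> ereal c} \<subseteq> {0..c + \<Lambda> 1}"
    unfolding eq by (auto, drule spec[of _ 1], simp)
  ultimately show "compact {x \<in> {0..}. ?J x \<le> ereal c}"
    by (meson bounded_closed_interval bounded_subset compact_eq_bounded_closed)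
qed

text \<open>
  Maximise \<open>\<theta> * x - \<Lambda> \<theta> - \<delta> * \<theta>\<^sup>2 / 2\<close>. The bound \<open>j\<close> on the rate at \<open>x\<close> controls the first two terms,
  so the quadratic penalty forces a maximum \<open>\<eta>\<close> to exist and bounds \<open>\<delta> * \<eta>\<^sup>2\<close> by a constant. At the
  maximum \<open>\<Lambda>' \<eta> = x - \<delta> * \<eta>\<close>, which is near \<open>x\<close> because \<open>(\<delta> * \<eta>)\<^sup>2\<close> is of order \<open>\<delta>\<close>; and replacing
  \<open>x\<close> by \<open>x - \<delta> * \<eta>\<close> lowers \<open>\<eta> * x - \<Lambda> \<eta>\<close> by \<open>\<delta> * \<eta>\<^sup>2 \<ge> 0\<close>.
\<close>

lemma exposed_point_near:
  fixes \<Lambda> :: "real \<Rightarrow> real"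
  assumes deriv: "\<And>\<theta>. (\<Lambda> has_real_derivative \<Lambda>' \<theta>) (at \<theta>)"
    and J: "\<And>\<theta>. \<theta> * x - \<Lambda> \<theta> \<le> j" and \<epsilon>: "0 < \<epsilon>"
  obtains \<eta> where "\<bar>\<Lambda>' \<eta> - x\<bar> < \<epsilon>" "\<eta> * \<Lambda>' \<eta> - \<Lambda> \<eta> \<le> j"
proof -
  \<comment> \<open>Bounds the excess of \<open>\<theta> * x - \<Lambda> \<theta>\<close> over its value at \<open>0\<close>; the \<open>1\<close> makes it positive.\<close>
  define b where "b = j + \<Lambda> 0 + 1"
  have b: "0 < b"
    using J[of 0] by (simp add: b_def)
  \<comment> \<open>At the maximum \<open>\<delta> * \<eta>\<^sup>2 < 2 * b\<close>, so this makes \<open>(\<delta> * \<eta>)\<^sup>2 < \<epsilon>\<^sup>2 / 2\<close>.\<close>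
  define \<delta> where "\<delta> = \<epsilon>\<^sup>2 / (4 * b)"
  have \<delta>: "0 < \<delta>"
    using b \<epsilon> by (simp add: \<delta>_def)
  define f where "f \<theta> = \<theta> * x - \<Lambda> \<theta> - \<delta> * \<theta>\<^sup>2 / 2" for \<theta>
  have outside: "f \<theta> < f 0" if "\<delta> * \<theta>\<^sup>2 / 2 \<ge> b" for \<theta>
    using J[of \<theta>] that by (simp add: f_def b_def)
  have f_deriv: "(f has_real_derivative x - \<Lambda>' \<theta> - \<delta> * \<theta>) (at \<theta>)" for \<theta>
    unfolding f_def by (auto intro!: derivative_eq_intros deriv)
  then have cont: "continuous_on A f" for A
    by (meson DERIV_isCont continuous_at_imp_continuous_on)
  define R where "R = sqrt (2 * b / \<delta>)"
  have R: "\<delta> * R\<^sup>2 / 2 = b" "0 < R"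
    using b \<delta> by (simp_all add: R_def)
  have big: "\<delta> * \<theta>\<^sup>2 / 2 \<ge> b" if "\<bar>\<theta>\<bar> \<ge> R" for \<theta>
  proof -
    have "R\<^sup>2 \<le> \<theta>\<^sup>2"
      using that R(2) by (metis abs_le_square_iff abs_of_pos)
    then show ?thesis
      using \<delta> R(1) by (metis divide_right_mono mult_left_mono less_imp_le zero_le_numeral)
  qed
  obtain \<eta> where \<eta>: "\<eta> \<in> {-R..R}" "\<And>\<theta>. \<theta> \<in> {-R..R} \<Longrightarrow> f \<theta> \<le> f \<eta>"
    using continuous_attains_sup[of "{-R..R}" f] cont R(2) by auto
  have max: "f \<theta> \<le> f \<eta>" for \<theta>
  proof (cases "\<theta> \<in> {-R..R}")
    case False
    then have "f \<theta> < f 0"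
      by (intro outside big) auto
    also have "f 0 \<le> f \<eta>"
      using R(2) by (intro \<eta>) auto
    finally show ?thesis by simp
  qed (rule \<eta>)
  have crit: "x - \<Lambda>' \<eta> - \<delta> * \<eta> = 0"
    using f_deriv[of \<eta>] max by (intro DERIV_local_max[of f _ \<eta> 1]) auto
  have "\<not> \<delta> * \<eta>\<^sup>2 / 2 \<ge> b"
    using outside[of \<eta>] max[of 0] by auto
  then have "\<delta> * (\<delta> * \<eta>\<^sup>2) < \<delta> * (2 * b)"
    using \<delta> by (intro mult_strict_left_mono) auto
  then have "(\<delta> * \<eta>)\<^sup>2 < 2 * b * \<delta>"
    by (simp add: power2_eq_square mult_ac)
  also have "\<dots> = \<epsilon>\<^sup>2 / 2"
    using b by (simp add: \<delta>_def)
  also have "\<dots> < \<epsilon>\<^sup>2"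
    using \<epsilon> by simp
  finally have "\<bar>\<delta> * \<eta>\<bar> < \<epsilon>"
    using \<epsilon> by (metis abs_le_square_iff abs_of_pos not_le)
  moreover have "\<Lambda>' \<eta> = x - \<delta> * \<eta>"
    using crit by simp
  moreover have "\<eta> * (x - \<delta> * \<eta>) - \<Lambda> \<eta> \<le> \<eta> * x - \<Lambda> \<eta>"
    using \<delta> by (simp add: algebra_simps)
  ultimately show thesis
    using J[of \<eta>] by (intro that[of \<eta>]) auto
qed

locale scaled_cumulants = prob_space M for M :: "'w measure" +
  fixes N :: "real \<Rightarrow> 'w \<Rightarrow> real" and \<Lambda> :: "real \<Rightarrow> real"
  assumes measurable_N: "0 < L \<Longrightarrow> N L \<in> borel_measurable M"
    and integrable_exp: "0 < L \<Longrightarrow> integrable M (\<lambda>\<omega>. exp (\<theta> * N L \<omega>))"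
    and cumulant_limit: "((\<lambda>L. ln (\<integral>\<omega>. exp (\<theta> * N L \<omega>) \<partial>M) / L) \<longlongrightarrow> \<Lambda> \<theta>) at_top"
begin

lemma moment_pos:
  assumes "0 < L"
  shows "0 < (\<integral>\<omega>. exp (\<theta> * N L \<omega>) \<partial>M)"
proof -
  have "(\<integral>\<omega>. exp (\<theta> * N L \<omega>) \<partial>M) \<noteq> 0"
    using integrable_exp[OF assms, of \<theta>] by (subst integral_nonneg_eq_0_iff_AE) (auto simp: AE_False)
  moreover have "0 \<le> (\<integral>\<omega>. exp (\<theta> * N L \<omega>) \<partial>M)"
    by simp
  ultimately show ?thesis
    by linarith
qed

lemma eventually_moment_less:
  assumes "\<Lambda> \<theta> < k"
  shows "\<forall>\<^sub>F L in at_top. (\<integral>\<omega>. exp (\<theta> * N L \<omega>) \<partial>M) < exp (k * L)"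
  using order_tendstoD(2)[OF cumulant_limit assms] eventually_gt_at_top[of 0]
proof eventually_elim
  case (elim L)
  then have "ln (\<integral>\<omega>. exp (\<theta> * N L \<omega>) \<partial>M) < k * L"
    by (simp add: divide_simps)
  then show ?case
    using moment_pos[OF elim(2)] by (metis exp_less_mono exp_ln)
qed

lemma eventually_moment_greater:
  assumes "k < \<Lambda> \<theta>"
  shows "\<forall>\<^sub>F L in at_top. exp (k * L) < (\<integral>\<omega>. exp (\<theta> * N L \<omega>) \<partial>M)"
  using order_tendstoD(1)[OF cumulant_limit assms] eventually_gt_at_top[of 0]
proof eventually_elim
  case (elim L)
  then have "k * L < ln (\<integral>\<omega>. exp (\<theta> * N L \<omega>) \<partial>M)"
    by (simp add: divide_simps)
  then show ?case
    using moment_pos[OF elim(2)] by (metis exp_less_mono exp_ln)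
qed

lemma integrable_tilted:
  assumes "0 < L" and "S \<in> sets M"
  shows "integrable M (\<lambda>\<omega>. exp (\<theta> * N L \<omega>) * indicator S \<omega>)"
  using integrable_real_mult_indicator[OF assms(2) integrable_exp[OF assms(1)]]
  by (simp add: mult.commute)

lemma half_line_event:
  assumes "0 < L"
  shows "{\<omega> \<in> space M. s * L \<le> t * N L \<omega>} \<in> sets M"
  using measurable_N[OF assms] by measurable

text \<open>
  Chernoff's inequality under the law tilted by \<open>exp (\<eta> * N L)\<close>. For \<open>\<eta> = 0\<close> it bounds probabilities,
  and the sign of \<open>t\<close> selects the upper or the lower tail.
\<close>

lemma eventually_tilted_tail_less:
  assumes "\<Lambda> (\<eta> + t) - s < k"
  shows "\<forall>\<^sub>F L in at_top.
    (\<integral>\<omega>. exp (\<eta> * N L \<omega>) * indicator {\<omega> \<in> space M. s * L \<le> t * N L \<omega>} \<omega> \<partial>M) < exp (k * L)"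
proof -
  from assms have "\<Lambda> (\<eta> + t) < k + s"
    by simp
  from eventually_moment_less[OF this] eventually_gt_at_top[of 0] show ?thesis
  proof eventually_elim
    case (elim L)
    have "(\<integral>\<omega>. exp (\<eta> * N L \<omega>) * indicator {\<omega> \<in> space M. s * L \<le> t * N L \<omega>} \<omega> \<partial>M)
        \<le> (\<integral>\<omega>. exp (- s * L) * exp ((\<eta> + t) * N L \<omega>) \<partial>M)"
      using elim(2)
      by (intro integral_mono integrable_tilted half_line_event integrable_mult_right integrable_exp)
        (auto simp: indicator_def algebra_simps simp flip: exp_add)
    also have "\<dots> < exp (- s * L) * exp ((k + s) * L)"
      using elim(1) by simp
    also have "\<dots> = exp (k * L)"
      by (simp add: algebra_simps flip: exp_add)
    finally show ?case .
  qed
qed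

lemma event_scaled:
  assumes "0 < L" and "A \<in> sets borel"
  shows "{\<omega> \<in> space M. N L \<omega> / L \<in> A} \<in> sets M"
  using measurable_N[OF assms(1)] assms(2) by measurable

text \<open>
  The condition on \<open>c\<close> says that the open sets \<open>{y. c < \<theta> * y - \<Lambda> \<theta>}\<close> cover \<open>F\<close>. Each has
  probability at most about \<open>exp (- c * L)\<close>. The one for \<open>\<theta> = 1\<close> leaves only a compact part of
  \<open>F\<close>, so finitely many suffice, and a finite number of them costs nothing on the exponential scale.
\<close>

lemma upper_bound:
  assumes F: "closed F" "F \<subseteq> {0..}"
    and c: "\<And>x. x \<in> F \<Longrightarrow> \<exists>\<theta>. c < \<theta> * x - \<Lambda> \<theta>" and less: "b < c"
  shows "\<forall>\<^sub>F L in at_top. prob {\<omega> \<in> space M. N L \<omega> / L \<in> F} < exp (- b * L)"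
proof -
  define U where "U \<theta> = {y. c < \<theta> * y - \<Lambda> \<theta>}" for \<theta>
  have openU: "open (U \<theta>)" for \<theta>
    unfolding U_def by (intro open_Collect_less continuous_intros)
  have tail: "F - U 1 \<subseteq> {0..c + \<Lambda> 1}"
    using F(2) by (auto simp: U_def)
  have "compact (F - U 1)"
    using F(1) openU tail
    by (meson bounded_closed_interval bounded_subset closed_Diff compact_eq_bounded_closed)
  moreover have "F - U 1 \<subseteq> (\<Union>\<theta>\<in>UNIV. U \<theta>)"
    using c by (auto simp: U_def)
  ultimately obtain T where T: "finite T" "F - U 1 \<subseteq> (\<Union>\<theta>\<in>T. U \<theta>)"
    using compactE_image[of "F - U 1" UNIV U] openU by metis
  define T' where "T' = insert 1 T"
  have T': "finite T'" "F \<subseteq> (\<Union>\<theta>\<in>T'. U \<theta>)"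
    using T by (auto simp: T'_def)
  obtain d where d: "b < d" "d < c"
    using less dense by blast
  have each: "\<forall>\<^sub>F L in at_top. prob {\<omega> \<in> space M. N L \<omega> / L \<in> U \<theta>} < exp (- d * L)" for \<theta>
  proof -
    have "\<Lambda> (0 + \<theta>) - (c + \<Lambda> \<theta>) < - d"
      using d by simp
    from eventually_tilted_tail_less[OF this] eventually_gt_at_top[of 0] show ?thesis
    proof eventually_elim
      case (elim L)
      have "prob {\<omega> \<in> space M. N L \<omega> / L \<in> U \<theta>}
          \<le> prob {\<omega> \<in> space M. (c + \<Lambda> \<theta>) * L \<le> \<theta> * N L \<omega>}"
        using elim(2) by (intro finite_measure_mono half_line_event) (auto simp: U_def field_simps)
      also have "\<dots> < exp (- d * L)"
        using elim(1) half_line_event[OF elim(2)] by simp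
      finally show ?case .
    qed
  qed
  have "\<forall>\<^sub>F L in at_top. \<forall>\<theta>\<in>T'. prob {\<omega> \<in> space M. N L \<omega> / L \<in> U \<theta>} < exp (- d * L)"
    using T'(1) each by (simp add: eventually_ball_finite_distrib)
  moreover have "filterlim (\<lambda>L::real. exp ((d - b) * L)) at_top at_top"
    using d by (intro filterlim_compose[OF exp_at_top] filterlim_tendsto_pos_mult_at_top[OF tendsto_const])
      (auto simp: filterlim_ident)
  then have "\<forall>\<^sub>F L in at_top. real (card T') < exp ((d - b) * L)"
    by (simp add: filterlim_at_top_dense)
  ultimately show ?thesis
    using eventually_gt_at_top[of 0]
  proof eventually_elim
    case (elim L)
    have "prob {\<omega> \<in> space M. N L \<omega> / L \<in> F} \<le> prob (\<Union>\<theta>\<in>T'. {\<omega> \<in> space M. N L \<omega> / L \<in> U \<theta>})"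
      using T' elim(3) openU
      by (intro finite_measure_mono sets.finite_UN event_scaled) auto
    also have "\<dots> \<le> (\<Sum>\<theta>\<in>T'. prob {\<omega> \<in> space M. N L \<omega> / L \<in> U \<theta>})"
      using T' elim(3) openU by (intro finite_measure_subadditive_finite) (auto intro!: event_scaled)
    also have "\<dots> \<le> (\<Sum>\<theta>\<in>T'. exp (- d * L))"
      using elim(1) by (intro sum_mono) (auto simp: less_imp_le)
    also have "\<dots> = real (card T') * exp (- d * L)"
      by simp
    also have "\<dots> < exp ((d - b) * L) * exp (- d * L)"
      using elim(2) by (intro mult_strict_right_mono) auto
    also have "\<dots> = exp (- b * L)"
      by (simp add: algebra_simps flip: exp_add)
    finally show ?case .
  qed
qed

text \<open>
  Since \<open>\<Lambda>\<close> has derivative \<open>y\<close> at \<open>\<eta>\<close>, for small \<open>t > 0\<close> the exponents \<open>\<Lambda> (\<eta> \<plusminus> t) \<mp> t * (y \<plusminus> r)\<close> of both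
  tilted tails outside \<open>(y - r, y + r)\<close> are smaller than \<open>\<Lambda> \<eta>\<close>, the exponent of the total tilted mass.
  So the tilted mass concentrates near \<open>y\<close>, where the tilting factor is about \<open>exp (\<eta> * y * L)\<close>.
\<close>

lemma lower_bound:
  assumes deriv: "(\<Lambda> has_real_derivative y) (at \<eta>)"
    and k: "k < \<Lambda> \<eta> - \<eta> * y" and \<epsilon>: "0 < \<epsilon>"
  shows "\<forall>\<^sub>F L in at_top. exp (k * L) < prob {\<omega> \<in> space M. \<bar>N L \<omega> / L - y\<bar> < \<epsilon>}"
proof -
  \<comment> \<open>One third of the gap pays for the width of the window, one third for the loss of tilted mass.\<close>
  define g where "g = \<Lambda> \<eta> - \<eta> * y - k"
  have g: "0 < g"
    using k by (simp add: g_def)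
  define r where "r = min \<epsilon> (g / (3 * (\<bar>\<eta>\<bar> + 1)))"
  have r: "0 < r" "r \<le> \<epsilon>"
    using g \<epsilon> by (auto simp: r_def)
  have \<eta>r: "\<bar>\<eta>\<bar> * r \<le> g / 3"
  proof -
    have "\<bar>\<eta>\<bar> * r \<le> (\<bar>\<eta>\<bar> + 1) * (g / (3 * (\<bar>\<eta>\<bar> + 1)))"
      using g r by (intro mult_mono) (auto simp: r_def)
    also have "\<dots> = g / 3"
      using abs_ge_zero[of \<eta>] by (simp add: divide_simps)
    finally show ?thesis .
  qed
  have "((\<lambda>h. (\<Lambda> (\<eta> + h) - \<Lambda> \<eta>) / h) \<longlongrightarrow> y) (at 0)"
    using deriv by (simp add: DERIV_def)
  then obtain d where d: "0 < d" and
    dist: "\<And>h. h \<noteq> 0 \<Longrightarrow> \<bar>h\<bar> < d \<Longrightarrow> \<bar>(\<Lambda> (\<eta> + h) - \<Lambda> \<eta>) / h - y\<bar> < r"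
    using r(1) by (auto simp: tendsto_iff eventually_at dist_real_def)
  define t where "t = d / 2"
  have t: "0 < t"
    using d by (simp add: t_def)
  have right: "\<Lambda> (\<eta> + t) - t * (y + r) < \<Lambda> \<eta>"
    using dist[of t] t d by (auto simp: t_def abs_less_iff field_simps)
  have left: "\<Lambda> (\<eta> + - t) - (- t) * (y - r) < \<Lambda> \<eta>"
    using dist[of "- t"] t d by (auto simp: t_def abs_less_iff field_simps)
  obtain \<kappa> where \<kappa>: "\<Lambda> (\<eta> + t) - t * (y + r) < \<kappa>" "\<Lambda> (\<eta> + - t) - (- t) * (y - r) < \<kappa>"
      "\<Lambda> \<eta> - g / 3 < \<kappa>" "\<kappa> < \<Lambda> \<eta>"
    using dense[of "max (\<Lambda> \<eta> - g / 3)
        (max (\<Lambda> (\<eta> + t) - t * (y + r)) (\<Lambda> (\<eta> + - t) - (- t) * (y - r)))" "\<Lambda> \<eta>"] right left g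
    by auto
  obtain m where m: "\<kappa> < m" "m < \<Lambda> \<eta>"
    using \<kappa>(4) dense by blast
  have "filterlim (\<lambda>L::real. exp ((m - \<kappa>) * L)) at_top at_top"
    using m by (intro filterlim_compose[OF exp_at_top] filterlim_tendsto_pos_mult_at_top[OF tendsto_const])
      (auto simp: filterlim_ident)
  \<comment> \<open>The total is then more than three times \<open>exp (\<kappa> * L)\<close>, and each tail takes at most one share.\<close>
  then have "\<forall>\<^sub>F L in at_top. 3 < exp ((m - \<kappa>) * L)"
    by (simp add: filterlim_at_top_dense)
  from this eventually_moment_greater[OF m(2)] eventually_tilted_tail_less[OF \<kappa>(1)]
    eventually_tilted_tail_less[OF \<kappa>(2)] eventually_gt_at_top[of 0]
  show ?thesis
  proof eventually_elim
    case (elim L)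
    let ?S = "{\<omega> \<in> space M. \<bar>N L \<omega> / L - y\<bar> < r}"
    let ?R = "{\<omega> \<in> space M. t * (y + r) * L \<le> t * N L \<omega>}"
    let ?Q = "{\<omega> \<in> space M. - t * (y - r) * L \<le> - t * N L \<omega>}"
    let ?E = "\<lambda>S. \<integral>\<omega>. exp (\<eta> * N L \<omega>) * indicator S \<omega> \<partial>M"
    have L: "0 < L"
      by (rule elim)
    have S: "?S \<in> sets M"
      using measurable_N[OF L] by measurable
    have "(\<integral>\<omega>. exp (\<eta> * N L \<omega>) \<partial>M) \<le> (\<integral>\<omega>. exp (\<eta> * N L \<omega>) * indicator ?S \<omega>
        + exp (\<eta> * N L \<omega>) * indicator ?R \<omega> + exp (\<eta> * N L \<omega>) * indicator ?Q \<omega> \<partial>M)"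
    proof (intro integral_mono integrable_exp Bochner_Integration.integrable_add integrable_tilted
        half_line_event S L)
      fix \<omega> assume \<omega>: "\<omega> \<in> space M"
      have "\<omega> \<in> ?S \<or> \<omega> \<in> ?R \<or> \<omega> \<in> ?Q"
      proof -
        have "t * ((y + r) * L) \<le> t * N L \<omega>" if "y + r \<le> N L \<omega> / L"
          using that L t by (intro mult_left_mono) (auto simp: field_simps)
        moreover have "t * N L \<omega> \<le> t * ((y - r) * L)" if "N L \<omega> / L \<le> y - r"
          using that L t by (intro mult_left_mono) (auto simp: field_simps)
        moreover have "\<bar>N L \<omega> / L - y\<bar> < r \<or> y + r \<le> N L \<omega> / L \<or> N L \<omega> / L \<le> y - r"
          by linarith
        ultimately show ?thesis
          using \<omega> by (auto simp: mult.assoc)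
      qed
      then show "exp (\<eta> * N L \<omega>) \<le> exp (\<eta> * N L \<omega>) * indicator ?S \<omega>
          + exp (\<eta> * N L \<omega>) * indicator ?R \<omega> + exp (\<eta> * N L \<omega>) * indicator ?Q \<omega>"
        by (auto simp: indicator_def)
    qed
    also have "\<dots> = ?E ?S + ?E ?R + ?E ?Q"
      by (simp only: Bochner_Integration.integral_add Bochner_Integration.integrable_add
          integrable_tilted[OF L S] integrable_tilted[OF L half_line_event[OF L]])
    finally have total: "(\<integral>\<omega>. exp (\<eta> * N L \<omega>) \<partial>M) \<le> ?E ?S + ?E ?R + ?E ?Q" .
    have "3 * exp (\<kappa> * L) < exp ((m - \<kappa>) * L) * exp (\<kappa> * L)"
      using elim(1) by simp
    also have "\<dots> = exp (m * L)"
      by (simp add: algebra_simps flip: exp_add)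
    finally have mass: "exp (\<kappa> * L) < ?E ?S"
      using total elim(2-4) by simp
    have "?E ?S \<le> (\<integral>\<omega>. exp ((\<eta> * y + \<bar>\<eta>\<bar> * r) * L) * indicator ?S \<omega> \<partial>M)"
    proof (intro integral_mono integrable_tilted S L integrable_mult_right)
      show "integrable M (indicator ?S :: _ \<Rightarrow> real)"
        by (intro integrable_real_indicator S) (simp add: less_top[symmetric])
      fix \<omega> assume \<omega>: "\<omega> \<in> space M"
      have "\<eta> * N L \<omega> \<le> (\<eta> * y + \<bar>\<eta>\<bar> * r) * L" if "\<omega> \<in> ?S"
      proof -
        have "\<eta> * (N L \<omega> / L - y) \<le> \<bar>\<eta>\<bar> * \<bar>N L \<omega> / L - y\<bar>"
          by (metis abs_ge_self abs_mult)
        also have "\<dots> \<le> \<bar>\<eta>\<bar> * r"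
          using that by (intro mult_left_mono) auto
        finally show ?thesis
          using L by (simp add: field_simps)
      qed
      then show "exp (\<eta> * N L \<omega>) * indicator ?S \<omega> \<le> exp ((\<eta> * y + \<bar>\<eta>\<bar> * r) * L) * indicator ?S \<omega>"
        by (auto simp: indicator_def)
    qed
    also have "\<dots> = exp ((\<eta> * y + \<bar>\<eta>\<bar> * r) * L) * prob ?S"
      using S by simp
    finally have "exp (\<kappa> * L) < exp ((\<eta> * y + \<bar>\<eta>\<bar> * r) * L) * prob ?S"
      using mass by simp
    then have "exp ((\<kappa> - (\<eta> * y + \<bar>\<eta>\<bar> * r)) * L) < prob ?S"
      by (simp only: left_diff_distrib exp_diff pos_divide_less_eq[OF exp_gt_zero]
          mult.commute[of "prob ?S"])
    moreover have "k * L \<le> (\<kappa> - (\<eta> * y + \<bar>\<eta>\<bar> * r)) * L"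
    proof (intro mult_right_mono)
      show "k \<le> \<kappa> - (\<eta> * y + \<bar>\<eta>\<bar> * r)"
        using \<kappa>(3) \<eta>r g unfolding g_def by argo
    qed (use L in simp)
    moreover have "prob ?S \<le> prob {\<omega> \<in> space M. \<bar>N L \<omega> / L - y\<bar> < \<epsilon>}"
      using r(2) measurable_N[OF L] by (intro finite_measure_mono) auto
    ultimately show ?case
      by (meson exp_le_cancel_iff order_le_less_trans order_less_le_trans)
  qed
qed

text \<open>
  Around a point \<open>x\<close> of a relatively open set there is a window of the line in which only negative
  values are missing, and those are not taken. A point \<open>\<Lambda>' \<eta>\<close> in this window with rate no larger than
  at \<open>x\<close>, up to an arbitrarily small error, carries enough mass for the lower bound. For the upper
  bound the relative closure is closed in the line, because the half-line is.
\<close>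

theorem gaertner_ellis:
  assumes deriv: "\<And>\<theta>. (\<Lambda> has_real_derivative \<Lambda>' \<theta>) (at \<theta>)"
    and nonneg: "\<And>L \<omega>. 0 < L \<Longrightarrow> \<omega> \<in> space M \<Longrightarrow> 0 \<le> N L \<omega>"
  shows "LDP_nonneg M (\<lambda>L \<omega>. N L \<omega> / L) (\<lambda>x. SUP \<theta>. ereal (\<theta> * x - \<Lambda> \<theta>))"
    (is "LDP_nonneg M _ ?J")
  unfolding LDP_nonneg_def Let_def
proof (intro conjI allI impI)
  show "good_rate_function ?J"
    by (rule legendre_good_rate_function)
next
  fix A :: "real set"
  assume "A \<in> sets borel \<and> A \<subseteq> {0..}"
  then have A: "A \<in> sets borel" "A \<subseteq> {0..}"
    by auto
  let ?r = "\<lambda>L. log_prob (prob {\<omega> \<in> space M. N L \<omega> / L \<in> A}) / ereal L"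
  let ?G = "Abstract_Topology.interior_of (top_of_set {0..}) A"
  let ?F = "Abstract_Topology.closure_of (top_of_set {0..}) A"
  show "Liminf at_top ?r \<le> Limsup at_top ?r"
    by (rule Liminf_le_Limsup) simp
  have point: "- ?J x \<le> Liminf at_top ?r" if x: "x \<in> ?G" for x
    unfolding le_Liminf_iff
  proof (intro allI impI)
    fix u assume "u < - ?J x"
    from ereal_dense2[OF this] obtain k where k: "u < ereal k" "ereal k < - ?J x"
      by auto
    then have "?J x < ereal (- k)"
      using ereal_less_uminus_reorder[of "ereal k"] by simp
    from ereal_dense2[OF this] obtain j where j: "?J x < ereal j" "j < - k"
      by auto
    have Jx: "\<theta> * x - \<Lambda> \<theta> \<le> j" for \<theta>
      using less_imp_le[OF j(1)] by (simp add: SUP_le_iff)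
    obtain T where T: "open T" "{0..} \<inter> T \<subseteq> A" "x \<in> T"
      using x by (auto simp: interior_of_def openin_open)
    then obtain \<epsilon> where \<epsilon>: "0 < \<epsilon>" "ball x \<epsilon> \<subseteq> T"
      by (meson openE)
    obtain \<eta> where \<eta>: "\<bar>\<Lambda>' \<eta> - x\<bar> < \<epsilon> / 2" "\<eta> * \<Lambda>' \<eta> - \<Lambda> \<eta> \<le> j"
      using exposed_point_near[OF deriv Jx] \<epsilon>(1) by (metis half_gt_zero)
    have "k < \<Lambda> \<eta> - \<eta> * \<Lambda>' \<eta>"
      using \<eta>(2) j(2) by simp
    from lower_bound[OF deriv this half_gt_zero[OF \<epsilon>(1)]] eventually_gt_at_top[of 0]
    show "\<forall>\<^sub>F L in at_top. u < ?r L"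
    proof eventually_elim
      case (elim L)
      have "N L \<omega> / L \<in> A" if "\<omega> \<in> space M" "\<bar>N L \<omega> / L - \<Lambda>' \<eta>\<bar> < \<epsilon> / 2" for \<omega>
      proof -
        have "\<bar>N L \<omega> / L - x\<bar> < \<epsilon>"
          using that(2) \<eta>(1) by linarith
        then have "N L \<omega> / L \<in> T"
          using \<epsilon>(2) by (auto simp: ball_def dist_real_def abs_minus_commute)
        then show ?thesis
          using T(2) nonneg[OF elim(2) that(1)] elim(2) by auto
      qed
      then have "prob {\<omega> \<in> space M. \<bar>N L \<omega> / L - \<Lambda>' \<eta>\<bar> < \<epsilon> / 2} \<le> prob {\<omega> \<in> space M. N L \<omega> / L \<in> A}"
        by (intro finite_measure_mono event_scaled[OF elim(2) A(1)]) blast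
      with elim(1) have less: "exp (k * L) < prob {\<omega> \<in> space M. N L \<omega> / L \<in> A}" (is "_ < ?p")
        by simp
      then have "0 < ?p"
        using exp_gt_zero[of "k * L"] by linarith
      with less have "k * L < ln ?p"
        by (intro exp_less_cancel[of _ "ln _"]) (simp only: exp_ln)
      moreover have "?p \<noteq> 0"
        using \<open>0 < ?p\<close> by linarith
      ultimately have "ereal k < ?r L"
        unfolding log_prob_div_greater_iff[OF elim(2)] by (intro conjI)
      then show "u < ?r L"
        by (rule less_trans[OF k(1)])
    qed
  qed
  show "- (INF x\<in>?G. ?J x) \<le> Liminf at_top ?r"
  proof -
    have "- Liminf at_top ?r \<le> ?J x" if "x \<in> ?G" for x
      using point[OF that] by (rule ereal_uminus_le_reorder[THEN iffD1])
    then have "- Liminf at_top ?r \<le> (INF x\<in>?G. ?J x)"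
      by (rule INF_greatest)
    then show ?thesis
      by (rule ereal_uminus_le_reorder[THEN iffD1])
  qed
  show "Limsup at_top ?r \<le> - (INF x\<in>?F. ?J x)"
    unfolding Limsup_le_iff
  proof (intro allI impI)
    fix u assume "- (INF x\<in>?F. ?J x) < u"
    then have "- u < (INF x\<in>?F. ?J x)"
      by (rule ereal_uminus_less_reorder[THEN iffD1])
    from ereal_dense2[OF this] obtain b where b: "- u < ereal b" "ereal b < (INF x\<in>?F. ?J x)"
      by auto
    from ereal_dense2[OF b(2)] obtain c where c: "b < c" "ereal c < (INF x\<in>?F. ?J x)"
      by auto
    have F: "closed ?F" "?F \<subseteq> {0..}"
      using closedin_closed_trans[OF closedin_closure_of closed_atLeast]
        closure_of_subset_topspace[of "top_of_set {0..}" A] by auto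
    have AF: "A \<subseteq> ?F"
      using A(2) by (intro closure_of_subset) simp
    have above: "\<exists>\<theta>. c < \<theta> * x - \<Lambda> \<theta>" if "x \<in> ?F" for x
    proof -
      have "ereal c < ?J x"
        using c(2) INF_lower[OF that] by (rule less_le_trans)
      then show ?thesis
        by (auto simp: less_SUP_iff)
    qed
    have "\<forall>\<^sub>F L in at_top. prob {\<omega> \<in> space M. N L \<omega> / L \<in> ?F} < exp (- b * L)"
      by (rule upper_bound[OF F above c(1)])
    from this eventually_gt_at_top[of 0]
    show "\<forall>\<^sub>F L in at_top. ?r L < u"
    proof eventually_elim
      case (elim L)
      have "prob {\<omega> \<in> space M. N L \<omega> / L \<in> A} \<le> prob {\<omega> \<in> space M. N L \<omega> / L \<in> ?F}"
        using AF by (intro finite_measure_mono event_scaled[OF elim(2)] borel_closed F(1)) blast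
      with elim(1) have less: "prob {\<omega> \<in> space M. N L \<omega> / L \<in> A} < exp (- b * L)" (is "?p < _")
        by simp
      have "?p = 0 \<or> ln ?p < - b * L"
      proof (cases "?p = 0")
        case False
        then have "0 < ?p"
          by (simp add: zero_less_measure_iff)
        with less have "ln ?p < - b * L"
          by (intro exp_less_cancel[of "ln _"]) (simp only: exp_ln)
        then show ?thesis ..
      qed simp
      then have "?r L < ereal (- b)"
        unfolding log_prob_div_less_iff[OF elim(2)] .
      also have "ereal (- b) < u"
        using ereal_uminus_less_reorder[THEN iffD1, OF b(1)] by simp
      finally show ?case .
    qed
  qed
qed

end

section \<open>The interval with arbitrary endpoints\<close>

theorem corollary1p5:
  fixes M :: "'w measure" and Z :: "'w \<Rightarrow> complex set" and \<alpha> \<beta> a :: real and I :: "real set"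
  assumes process: "determinantal_process M upper_half_plane K_H Z"
    and "0 < \<alpha>" and "\<alpha> < \<beta>"
    and I_def: "I = {\<alpha>..\<beta>}" and a_def: "a = \<beta> / \<alpha>"
    and reference: "reference_asymptotics M Z a"
  shows "limits_exist M Z I \<and>
    (\<forall>\<theta>\<in>S_pi. Lambda M Z I \<theta> = of_real (1 / \<alpha>) * Lambda M Z {1..a} \<theta>) \<and>
    (\<forall>x\<ge>0. rate_J M Z I x = ereal (1 / \<alpha>) * rate_J M Z {1..a} (\<alpha> * x)) \<and>
    (\<forall>\<theta>\<in>S_pi. szego_C M Z I \<theta> = szego_C M Z {1..a} \<theta>) \<and>
    LDP_nonneg M (\<lambda>L \<omega>. real (box_count Z I L \<omega>) / L) (rate_J M Z I) \<and>
    szego_locally_uniform M Z I"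
proof -
  have I: "I = {\<alpha>..\<alpha> * a}"
    using \<open>0 < \<alpha>\<close> by (simp add: I_def a_def)
  have known: "limits_exist M Z {1..a}" "szego_locally_uniform M Z {1..a}"
    using reference by (simp_all add: reference_asymptotics_def)
  interpret mgf_dilation M Z I "{1..a}" \<alpha>
  proof
    fix L :: real
    assume "0 < L"
    then have "is_log_mgf M Z {1..a} (L / \<alpha>) (log_mgf M Z {1..a} (L / \<alpha>))"
      using known(1) \<open>0 < \<alpha>\<close> by (simp add: limits_exist_def)
    then show "mgf M Z I L = mgf M Z {1..a} (L / \<alpha>)"
      unfolding I by (rule mgf_box_dilation[OF process \<open>0 < \<alpha>\<close>])
  qed (fact \<open>0 < \<alpha>\<close>, fact known(1))
  have prob: "prob_space M"
    using process unfolding determinantal_process_def simple_point_process_def by (elim conjE)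
  interpret cumulants: scaled_cumulants M "\<lambda>L \<omega>. real (box_count Z I L \<omega>)" "Lambda_real M Z I"
  proof (intro scaled_cumulants.intro scaled_cumulants_axioms.intro prob)
    fix L :: real assume L: "0 < L"
    have "box_count Z I L \<in> measurable M (count_space UNIV)"
      unfolding I_def using process \<open>0 < \<alpha>\<close> by (rule box_count_measurable)
    then show "(\<lambda>\<omega>. real (box_count Z I L \<omega>)) \<in> borel_measurable M"
      by measurable
    show "integrable M (\<lambda>\<omega>. exp (\<theta> * real (box_count Z I L \<omega>)))" for \<theta>
      using is_log_mgf[OF L] by (rule is_log_mgf_imp_integrable)
  next
    show "((\<lambda>L. ln (\<integral>\<omega>. exp (\<theta> * real (box_count Z I L \<omega>)) \<partial>M) / L)
        \<longlongrightarrow> Lambda_real M Z I \<theta>) at_top" for \<theta>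
      unfolding Lambda_real_eq by (rule cumulant_limit)
  qed
  have "LDP_nonneg M (\<lambda>L \<omega>. real (box_count Z I L \<omega>) / L) (rate_J M Z I)"
    unfolding rate_J_def[abs_def]
    by (rule cumulants.gaertner_ellis[OF
          real_derivative_of_holomorphic[OF Lambda_holomorphic Lambda_of_real]]) simp
  then show ?thesis
    using limits_exist Lambda_eq rate_J_eq szego_C_eq szego_locally_uniform[OF known(2)] by blast
qed

end
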